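(* Let $k$ be a field of characteristic $2$ and let $R$ be the localization at the ideal $(x_1,\ldots,x_5)$ of the ring $$\frac{k[x_1,\ldots,x_5]}{(x_1^5+x_2^5+x_3^5+x_4^5+x_5^5)}.$$ Then the test ideal $\tau$ of $R$ is the ideal generated by the elements $x_i^2x_j$ for all $1\le i,j\le 5$ (the case $i=j$ included).
   Context: Let $R$ be a commutative Noetherian ring of prime characteristic $p>0$; the letter $q$ always denotes a power $p^e$, $e\in\mathbb{N}$. For an ideal $I\subseteq R$, $I^{[q]}$ is the ideal generated by the $q$th powers of all elements of $I$. An element $u\in R$ is in the tight closure $I^*$ of $I$ if there exists $c\in R$, not in any minimal prime of $R$, such that $cu^q\in I^{[q]}$ for all large $q=p^e$. The test ideal $\tau$ of $R$ is the ideal of all $c\in R$ such that for every ideal $I\subseteq R$ and every $u\in I^*$ one has $cu^q\in I^{[q]}$ for all $q=p^e$. *)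

theory Defs
  imports "HOL-Algebra.QuotRing" "HOL-Library.Poly_Mapping" "HOL-Library.Numeral_Type"
begin

section \<open>Tight closure and the test ideal\<close>

definition minimal_prime :: "('a, 'm) ring_scheme \<Rightarrow> 'a set \<Rightarrow> bool" where
  "minimal_prime R P \<longleftrightarrow> primeideal P R \<and> (\<forall>Q. primeideal Q R \<and> Q \<subseteq> P \<longrightarrow> Q = P)"

definition frobenius_power :: "('a, 'm) ring_scheme \<Rightarrow> 'a set \<Rightarrow> nat \<Rightarrow> 'a set" where
  "frobenius_power R I q = Idl\<^bsub>R\<^esub> {a [^]\<^bsub>R\<^esub> q | a. a \<in> I}"

text \<open>
  The following two notions are meant for a commutative Noetherian ring \<open>R\<close> whose
  characteristic is the prime \<open>p\<close>.
\<close>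

definition tight_closure :: "nat \<Rightarrow> ('a, 'm) ring_scheme \<Rightarrow> 'a set \<Rightarrow> 'a set" where
  "tight_closure p R I =
    {u \<in> carrier R. \<exists>c \<in> carrier R. (\<forall>P. minimal_prime R P \<longrightarrow> c \<notin> P) \<and>
      (\<exists>e\<^sub>0. \<forall>e \<ge> e\<^sub>0. c \<otimes>\<^bsub>R\<^esub> u [^]\<^bsub>R\<^esub> (p ^ e) \<in> frobenius_power R I (p ^ e))}"

definition test_ideal :: "nat \<Rightarrow> ('a, 'm) ring_scheme \<Rightarrow> 'a set" where
  "test_ideal p R =
    {c \<in> carrier R. \<forall>I. ideal I R \<longrightarrow> (\<forall>u \<in> tight_closure p R I. \<forall>e.
      c \<otimes>\<^bsub>R\<^esub> u [^]\<^bsub>R\<^esub> (p ^ e) \<in> frobenius_power R I (p ^ e))}"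


section \<open>Localization of a commutative ring\<close>

definition frac_rel :: "('a, 'm) ring_scheme \<Rightarrow> 'a set \<Rightarrow> (('a \<times> 'a) \<times> ('a \<times> 'a)) set" where
  "frac_rel R S = {((a, s), (b, t)). a \<in> carrier R \<and> s \<in> S \<and> b \<in> carrier R \<and> t \<in> S \<and>
    (\<exists>w \<in> S. w \<otimes>\<^bsub>R\<^esub> (a \<otimes>\<^bsub>R\<^esub> t) = w \<otimes>\<^bsub>R\<^esub> (b \<otimes>\<^bsub>R\<^esub> s))}"

definition fraction :: "('a, 'm) ring_scheme \<Rightarrow> 'a set \<Rightarrow> 'a \<Rightarrow> 'a \<Rightarrow> ('a \<times> 'a) set" where
  "fraction R S a s = frac_rel R S `` {(a, s)}"

text \<open>
  As for \<^const>\<open>rcoset_mult\<close>, the operations are unions over all representatives; by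
  well-definedness (lemmas \<open>localization_add\<close> and \<open>localization_mult\<close> below) all members
  of such a union agree.
\<close>

definition localization :: "('a, 'm) ring_scheme \<Rightarrow> 'a set \<Rightarrow> ('a \<times> 'a) set ring" where
  "localization R S =
    \<lparr>carrier = (carrier R \<times> S) // frac_rel R S,
     monoid.mult = (\<lambda>X Y. \<Union>(a, s)\<in>X. \<Union>(b, t)\<in>Y. fraction R S (a \<otimes>\<^bsub>R\<^esub> b) (s \<otimes>\<^bsub>R\<^esub> t)),
     one = fraction R S \<one>\<^bsub>R\<^esub> \<one>\<^bsub>R\<^esub>,
     zero = fraction R S \<zero>\<^bsub>R\<^esub> \<one>\<^bsub>R\<^esub>,
     add = (\<lambda>X Y. \<Union>(a, s)\<in>X. \<Union>(b, t)\<in>Y.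
       fraction R S (a \<otimes>\<^bsub>R\<^esub> t \<oplus>\<^bsub>R\<^esub> b \<otimes>\<^bsub>R\<^esub> s) (s \<otimes>\<^bsub>R\<^esub> t))\<rparr>"

abbreviation localization_at :: "('a, 'm) ring_scheme \<Rightarrow> 'a set \<Rightarrow> ('a \<times> 'a) set ring" where
  "localization_at R P \<equiv> localization R (carrier R - P)"

locale mult_subset = cring R + submonoid S R for R (structure) and S
begin

lemma S_carrier: "s \<in> S \<Longrightarrow> s \<in> carrier R"
  using subset by blast

lemma frac_rel_equiv: "equiv (carrier R \<times> S) (frac_rel R S)"
proof (rule equivI)
  show "frac_rel R S \<subseteq> (carrier R \<times> S) \<times> (carrier R \<times> S)"
    by (auto simp: frac_rel_def)
  show "refl_on (carrier R \<times> S) (frac_rel R S)"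
    by (auto simp: refl_on_def frac_rel_def intro: one_closed)
  show "sym (frac_rel R S)"
    by (auto simp: sym_def frac_rel_def) metis
  show "trans (frac_rel R S)"
  proof (rule transI, clarify)
    fix a s b t c u
    assume "((a, s), (b, t)) \<in> frac_rel R S" "((b, t), (c, u)) \<in> frac_rel R S"
    then obtain v w where S: "s \<in> S" "t \<in> S" "u \<in> S" "v \<in> S" "w \<in> S"
      and C: "a \<in> carrier R" "b \<in> carrier R" "c \<in> carrier R"
      and v: "v \<otimes> (a \<otimes> t) = v \<otimes> (b \<otimes> s)" and w: "w \<otimes> (b \<otimes> u) = w \<otimes> (c \<otimes> t)"
      by (auto simp: frac_rel_def)
    note car = C S[THEN S_carrier]
    have "(v \<otimes> w \<otimes> t) \<otimes> (a \<otimes> u) = w \<otimes> u \<otimes> (v \<otimes> (a \<otimes> t))"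
      using car by (simp add: m_ac)
    also have "\<dots> = v \<otimes> s \<otimes> (w \<otimes> (b \<otimes> u))"
      unfolding v using car by (simp add: m_ac)
    also have "\<dots> = (v \<otimes> w \<otimes> t) \<otimes> (c \<otimes> s)"
      unfolding w using car by (simp add: m_ac)
    finally show "((a, s), (c, u)) \<in> frac_rel R S"
      using S C by (auto simp: frac_rel_def intro!: bexI[of _ "v \<otimes> w \<otimes> t"])
  qed
qed

lemma fraction_eq_iff:
  assumes "a \<in> carrier R" "s \<in> S" "b \<in> carrier R" "t \<in> S"
  shows "fraction R S a s = fraction R S b t \<longleftrightarrow> (\<exists>w \<in> S. w \<otimes> (a \<otimes> t) = w \<otimes> (b \<otimes> s))"
  unfolding fraction_def using assms
  by (subst eq_equiv_class_iff[OF frac_rel_equiv]) (auto simp: frac_rel_def)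

lemma fraction_carrier:
  "a \<in> carrier R \<Longrightarrow> s \<in> S \<Longrightarrow> fraction R S a s \<in> carrier (localization R S)"
  by (auto simp: localization_def fraction_def intro: quotientI)

lemma localization_cases:
  assumes "X \<in> carrier (localization R S)"
  obtains a s where "a \<in> carrier R" "s \<in> S" "X = fraction R S a s"
  using assms by (auto simp: localization_def fraction_def elim!: quotientE)

lemma fraction_mem:
  "(a', s') \<in> fraction R S a s \<longleftrightarrow> a \<in> carrier R \<and> s \<in> S \<and> a' \<in> carrier R \<and> s' \<in> S \<and>
    (\<exists>w \<in> S. w \<otimes> (a \<otimes> s') = w \<otimes> (a' \<otimes> s))"
  by (auto simp: fraction_def frac_rel_def)

lemma Union_fraction:
  assumes "a \<in> carrier R" "s \<in> S" "b \<in> carrier R" "t \<in> S"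
    and "\<And>a' s' b' t'. (a', s') \<in> fraction R S a s \<Longrightarrow> (b', t') \<in> fraction R S b t \<Longrightarrow> f a' s' b' t' = Z"
  shows "(\<Union>(a', s')\<in>fraction R S a s. \<Union>(b', t')\<in>fraction R S b t. f a' s' b' t') = Z"
proof -
  have "(a, s) \<in> fraction R S a s" "(b, t) \<in> fraction R S b t"
    using assms by (auto simp: fraction_mem intro: one_closed)
  then show ?thesis using assms(5) by fastforce
qed

lemma localization_mult:
  assumes "a \<in> carrier R" "s \<in> S" "b \<in> carrier R" "t \<in> S"
  shows "fraction R S a s \<otimes>\<^bsub>localization R S\<^esub> fraction R S b t = fraction R S (a \<otimes> b) (s \<otimes> t)"
proof -
  have "fraction R S (a' \<otimes> b') (s' \<otimes> t') = fraction R S (a \<otimes> b) (s \<otimes> t)"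
    if as: "(a', s') \<in> fraction R S a s" and bt: "(b', t') \<in> fraction R S b t" for a' s' b' t'
  proof -
    from as bt obtain v w where S: "s' \<in> S" "t' \<in> S" "v \<in> S" "w \<in> S"
      and C: "a' \<in> carrier R" "b' \<in> carrier R"
      and v: "v \<otimes> (a \<otimes> s') = v \<otimes> (a' \<otimes> s)" and w: "w \<otimes> (b \<otimes> t') = w \<otimes> (b' \<otimes> t)"
      by (auto simp: fraction_mem)
    note car = C assms S[THEN S_carrier] assms(2,4)[THEN S_carrier]
    have "(v \<otimes> w) \<otimes> ((a' \<otimes> b') \<otimes> (s \<otimes> t)) = (v \<otimes> (a' \<otimes> s)) \<otimes> (w \<otimes> (b' \<otimes> t))"
      using car by (simp add: m_ac)
    also have "\<dots> = (v \<otimes> w) \<otimes> ((a \<otimes> b) \<otimes> (s' \<otimes> t'))"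
      unfolding v[symmetric] w[symmetric] using car by (simp add: m_ac)
    finally show ?thesis
      using S C assms by (subst fraction_eq_iff) (auto intro!: bexI[of _ "v \<otimes> w"])
  qed
  then show ?thesis
    unfolding localization_def by (simp add: Union_fraction[OF assms])
qed

lemma localization_add:
  assumes "a \<in> carrier R" "s \<in> S" "b \<in> carrier R" "t \<in> S"
  shows "fraction R S a s \<oplus>\<^bsub>localization R S\<^esub> fraction R S b t = fraction R S (a \<otimes> t \<oplus> b \<otimes> s) (s \<otimes> t)"
proof -
  have "fraction R S (a' \<otimes> t' \<oplus> b' \<otimes> s') (s' \<otimes> t') = fraction R S (a \<otimes> t \<oplus> b \<otimes> s) (s \<otimes> t)"
    if as: "(a', s') \<in> fraction R S a s" and bt: "(b', t') \<in> fraction R S b t" for a' s' b' t'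
  proof -
    from as bt obtain v w where S: "s' \<in> S" "t' \<in> S" "v \<in> S" "w \<in> S"
      and C: "a' \<in> carrier R" "b' \<in> carrier R"
      and v: "v \<otimes> (a \<otimes> s') = v \<otimes> (a' \<otimes> s)" and w: "w \<otimes> (b \<otimes> t') = w \<otimes> (b' \<otimes> t)"
      by (auto simp: fraction_mem)
    note car = C assms S[THEN S_carrier] assms(2,4)[THEN S_carrier]
    have "(v \<otimes> w) \<otimes> ((a' \<otimes> t' \<oplus> b' \<otimes> s') \<otimes> (s \<otimes> t)) =
        w \<otimes> t \<otimes> t' \<otimes> (v \<otimes> (a' \<otimes> s)) \<oplus> v \<otimes> s \<otimes> s' \<otimes> (w \<otimes> (b' \<otimes> t))"
      using car by (simp add: m_ac l_distr r_distr)
    also have "\<dots> = (v \<otimes> w) \<otimes> ((a \<otimes> t \<oplus> b \<otimes> s) \<otimes> (s' \<otimes> t'))"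
      unfolding v[symmetric] w[symmetric] using car by (simp add: m_ac l_distr r_distr)
    finally show ?thesis
      using S C assms S_carrier by (subst fraction_eq_iff) (auto intro!: bexI[of _ "v \<otimes> w"])
  qed
  then show ?thesis
    unfolding localization_def by (simp add: Union_fraction[OF assms])
qed

lemma cring_localization: "cring (localization R S)"
proof (rule cringI)
  let ?L = "localization R S"
  have one: "\<one>\<^bsub>?L\<^esub> = fraction R S \<one> \<one>" and zero: "\<zero>\<^bsub>?L\<^esub> = fraction R S \<zero> \<one>"
    by (auto simp: localization_def)
  note L = localization_mult localization_add one zero fraction_carrier S_carrier
  show "abelian_group ?L"
  proof (rule abelian_groupI)
    fix X assume "X \<in> carrier ?L"
    then obtain a s where X: "a \<in> carrier R" "s \<in> S" "X = fraction R S a s"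
      by (rule localization_cases)
    have "fraction R S (\<ominus> a) s \<oplus>\<^bsub>?L\<^esub> X = \<zero>\<^bsub>?L\<^esub>"
      using X(1,2) S_carrier[OF X(2)]
      by (auto simp: X(3) L l_minus fraction_eq_iff l_neg intro!: bexI[of _ \<one>])
    then show "\<exists>Y \<in> carrier ?L. Y \<oplus>\<^bsub>?L\<^esub> X = \<zero>\<^bsub>?L\<^esub>"
      using X by (blast intro: fraction_carrier a_inv_closed)
  qed (auto elim!: localization_cases simp: L l_distr r_distr m_ac a_ac)
  show "comm_monoid ?L"
    by (rule comm_monoidI) (auto elim!: localization_cases simp: L m_ac)
  fix X Y Z assume "X \<in> carrier ?L" "Y \<in> carrier ?L" "Z \<in> carrier ?L"
  then obtain a s b t c u where X: "a \<in> carrier R" "s \<in> S" "X = fraction R S a s"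
    and Y: "b \<in> carrier R" "t \<in> S" "Y = fraction R S b t"
    and Z: "c \<in> carrier R" "u \<in> S" "Z = fraction R S c u"
    by (elim localization_cases)
  note car = X(1) Y(1) Z(1) X(2)[THEN S_carrier] Y(2)[THEN S_carrier] Z(2)[THEN S_carrier]
  show "(X \<oplus>\<^bsub>?L\<^esub> Y) \<otimes>\<^bsub>?L\<^esub> Z = X \<otimes>\<^bsub>?L\<^esub> Z \<oplus>\<^bsub>?L\<^esub> Y \<otimes>\<^bsub>?L\<^esub> Z"
    using X(1,2) Y(1,2) Z(1,2) car unfolding X(3) Y(3) Z(3)
    by (auto simp: L fraction_eq_iff l_distr r_distr m_ac intro!: bexI[of _ \<one>])
qed

end


section \<open>The local ring of the diagonal quintic in five variables\<close>

text \<open>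
  The index type \<^typ>\<open>5\<close> has exactly five elements, so \<open>'k poly5\<close> is the polynomial ring in
  five variables over \<open>'k\<close>: finitely supported functions from exponent vectors to coefficients.
\<close>

type_synonym 'k poly5 = "(5 \<Rightarrow>\<^sub>0 nat) \<Rightarrow>\<^sub>0 'k"

type_synonym 'k quintic_elem = "('k poly5 set \<times> 'k poly5 set) set"

definition poly5_ring :: "'k::field poly5 ring" where
  "poly5_ring = \<lparr>carrier = UNIV, monoid.mult = (*), one = 1, zero = 0, add = (+)\<rparr>"

lemma cring_poly5_ring: "cring poly5_ring"
  by (unfold_locales)
    (auto simp: poly5_ring_def Units_def algebra_simps intro: exI[of _ "- x" for x])

definition poly5_var :: "5 \<Rightarrow> 'k::field poly5" where
  "poly5_var i = Poly_Mapping.single (Poly_Mapping.single i 1) 1"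

definition quintic_ideal :: "'k::field poly5 set" where
  "quintic_ideal = Idl\<^bsub>poly5_ring\<^esub> {\<Sum>i\<in>UNIV. poly5_var i ^ 5}"

definition quintic_quot :: "'k::field poly5 set ring" where
  "quintic_quot = poly5_ring Quot quintic_ideal"

definition quot_var :: "5 \<Rightarrow> 'k::field poly5 set" where
  "quot_var i = quintic_ideal +>\<^bsub>poly5_ring\<^esub> poly5_var i"

definition quot_origin :: "'k::field poly5 set set" where
  "quot_origin = Idl\<^bsub>quintic_quot\<^esub> (range quot_var)"

definition quintic_ring :: "'k::field quintic_elem ring" where
  "quintic_ring = localization_at quintic_quot quot_origin"

definition quintic_var :: "5 \<Rightarrow> 'k::field quintic_elem" where
  "quintic_var i =
    fraction quintic_quot (carrier quintic_quot - quot_origin) (quot_var i) \<one>\<^bsub>quintic_quot\<^esub>"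

end

theory Submission
  imports Defs "HOL-Computational_Algebra.Polynomial"
begin

text \<open>
  Write \<open>F\<close> for the quintic and let \<open>q\<close> be a power of \<open>2\<close>.

  \<^bold>\<open>Upper bound.\<close> Modulo \<open>F\<close>, the fifth power of one variable is the sum of the fifth powers of
  the others. Hence the square of \<open>x\<^sub>i\<^sup>3 \<Prod>\<^bsub>j\<noteq>i\<^esub> x\<^sub>j\<^sup>2\<close> and the fourth power of \<open>x\<^sub>i\<^sup>2 \<Prod>\<^bsub>j\<noteq>i\<^esub> x\<^sub>j\<^sup>3\<close> lie in the
  corresponding Frobenius powers of \<open>I = (x\<^sub>j\<^sup>4 : j \<noteq> i)\<close>, so both monomials are in the tight closure
  of \<open>I\<close>. The intersection of the colon ideals is monomial and equals \<open>(x\<^sub>i\<^sup>2 x\<^sub>j)\<close>.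

  \<^bold>\<open>Lower bound.\<close> If \<open>d u\<^sup>q \<in> I\<^bsup>[q]\<^esup>\<close> for all large \<open>q\<close> and \<open>\<phi>\<close> is a \<open>q\<close>-inverse-linear map on the
  polynomial ring, then \<open>\<phi>(F\<^bsup>q-1\<^esup> d) u\<^bsup>q'\<^esup> \<in> I\<^bsup>[q']\<^esup>\<close> for all \<open>q'\<close>. Any \<open>d\<close> outside \<open>(F)\<close> has a nonzero
  multiple modulo \<open>F\<close> that is free of \<open>x\<^sub>0\<close>, and such a multiple is sent to \<open>x\<^sub>0\<^sup>4\<close> by some \<open>\<phi>\<close>.
  For \<open>q = 2\<close> the maps \<open>d \<mapsto> \<phi>(F d)\<close> act on monomials by adding \<open>5\<close> to one exponent and
  then halving all exponents with rounding down; starting from \<open>x\<^sub>0\<^sup>4\<close> this reaches every \<open>x\<^sub>i\<^sup>2 x\<^sub>j\<close>.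
\<close>

abbreviation lookup :: "('v \<Rightarrow>\<^sub>0 'k::zero) \<Rightarrow> 'v \<Rightarrow> 'k" where
  "lookup \<equiv> Poly_Mapping.lookup"

abbreviation keys :: "('v \<Rightarrow>\<^sub>0 'k::zero) \<Rightarrow> 'v set" where
  "keys \<equiv> Poly_Mapping.keys"

abbreviation single :: "'v \<Rightarrow> 'k \<Rightarrow> ('v \<Rightarrow>\<^sub>0 'k::zero)" where
  "single \<equiv> Poly_Mapping.single"

section \<open>Additive maps on the polynomial ring\<close>

text \<open>Every function on the five-element index type has finite support, so \<open>expo\<close>
  is total and inverse to \<open>lookup\<close>.\<close>

definition expo :: "(5 \<Rightarrow> nat) \<Rightarrow> (5 \<Rightarrow>\<^sub>0 nat)" where
  "expo = Abs_poly_mapping"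

lemma lookup_expo [simp]: "lookup (expo f) i = f i"
  by (simp add: expo_def)

lemma expo_add: "expo f + expo g = expo (\<lambda>i. f i + g i)"
  by (rule poly_mapping_eqI) (simp add: lookup_add)

lemma expo_eq_iff [simp]: "expo f = expo g \<longleftrightarrow> f = g"
  by (metis lookup_expo ext)

lemma sum_single_keys: "(\<Sum>v\<in>keys p. single v (lookup p v)) = (p :: 'v \<Rightarrow>\<^sub>0 'k::comm_monoid_add)"
proof (rule poly_mapping_eqI)
  fix w
  have "lookup (\<Sum>v\<in>keys p. single v (lookup p v)) w = (\<Sum>v\<in>keys p. if v = w then lookup p v else 0)"
    by (auto simp: lookup_sum lookup_single when_def intro!: sum.cong)
  also have "\<dots> = lookup p w"
    by (simp add: in_keys_iff)
  finally show "lookup (\<Sum>v\<in>keys p. single v (lookup p v)) w = lookup p w" .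
qed

text \<open>The case of a single term keeps \<open>v \<in> keys p\<close>, so that hypotheses on the
  support of \<open>p\<close> stay available.\<close>

lemma additive_induct [case_names zero single add]:
  fixes p :: "'v \<Rightarrow>\<^sub>0 'k::comm_monoid_add"
  assumes "P 0" "\<And>v c. c \<noteq> 0 \<Longrightarrow> v \<in> keys p \<Longrightarrow> P (single v c)"
    and add: "\<And>a b. P a \<Longrightarrow> P b \<Longrightarrow> P (a + b)"
  shows "P p"
proof -
  have "P (\<Sum>v\<in>A. single v (lookup p v))" if "A \<subseteq> keys p" for A
    using finite_subset[OF that finite_keys] that
    by (induction A rule: finite_induct) (auto simp: in_keys_iff intro!: assms)
  from this[of "keys p"] show ?thesis by (simp add: sum_single_keys)
qed

text \<open>The coefficient is an argument of \<open>g\<close> rather than an outer scalar, because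
  inverse Frobenius maps are additive but not linear in the coefficients.\<close>

definition additive_ext :: "('v \<Rightarrow> 'k \<Rightarrow> 'r) \<Rightarrow> ('v \<Rightarrow>\<^sub>0 'k::zero) \<Rightarrow> 'r::comm_monoid_add" where
  "additive_ext g p = (\<Sum>v\<in>keys p. g v (lookup p v))"

locale additive_family =
  fixes g :: "'v \<Rightarrow> 'k::comm_monoid_add \<Rightarrow> 'r::comm_monoid_add"
  assumes g_zero: "g v 0 = 0" and g_add: "g v (a + b) = g v a + g v b"
begin

lemma ext_zero [simp]: "additive_ext g 0 = 0"
  by (simp add: additive_ext_def)

lemma ext_single [simp]: "additive_ext g (single v c) = g v c"
  by (cases "c = 0") (auto simp: additive_ext_def g_zero)

lemma ext_superset:
  assumes "finite A" "keys p \<subseteq> A"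
  shows "additive_ext g p = (\<Sum>v\<in>A. g v (lookup p v))"
  unfolding additive_ext_def
  by (rule sum.mono_neutral_left) (use assms in \<open>auto simp: in_keys_iff g_zero\<close>)

lemma ext_add: "additive_ext g (p + q) = additive_ext g p + additive_ext g q"
  using keys_add[of p q]
  by (simp add: ext_superset[of "keys p \<union> keys q"] lookup_add g_add sum.distrib)

lemma ext_sum: "additive_ext g (\<Sum>i\<in>A. f i) = (\<Sum>i\<in>A. additive_ext g (f i))"
  by (induction A rule: infinite_finite_induct) (auto simp: ext_add)

end

locale multiplicative_family = additive_family g
  for g :: "'v::comm_monoid_add \<Rightarrow> 'k::comm_semiring_1 \<Rightarrow> 'r::comm_semiring_1" +
  assumes g_one: "g 0 1 = 1" and g_mult: "g (v + w) (a * b) = g v a * g w b"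
begin

lemma ext_one [simp]: "additive_ext g 1 = 1"
  using ext_single[of 0 1] by (simp add: g_one)

lemma ext_mult: "additive_ext g (p * q) = additive_ext g p * additive_ext g q"
proof (induction p rule: additive_induct)
  case (single v c)
  show ?case
    by (induction q rule: additive_induct)
      (auto simp: mult_single g_mult ext_add distrib_left)
qed (auto simp: ext_add distrib_right)

lemma ext_power: "additive_ext g (p ^ n) = additive_ext g p ^ n"
  by (induction n) (auto simp: ext_mult)

end

section \<open>Monomials\<close>

abbreviation mon :: "(5 \<Rightarrow> nat) \<Rightarrow> 'k::field poly5" where
  "mon f \<equiv> single (expo f) 1"

lemma mon_mult: "mon f * mon g = mon (\<lambda>i. f i + g i)"
  by (simp add: mult_single expo_add)

lemma expo_zero: "expo (\<lambda>_. 0) = 0"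
  by (rule poly_mapping_eqI) simp

lemma mon_power: "mon f ^ n = mon (\<lambda>i. n * f i)"
  by (induction n) (auto simp: mon_mult expo_zero)

lemma single_power: "single v c ^ n = single (expo (\<lambda>i. n * lookup v i)) (c ^ n)"
proof (induction n)
  case (Suc n)
  have "v + expo (\<lambda>i. n * lookup v i) = expo (\<lambda>i. Suc n * lookup v i)"
    by (rule poly_mapping_eqI) (simp add: lookup_add)
  then show ?case by (simp add: Suc mult_single)
qed (simp add: expo_zero)

lemma poly5_var_eq: "poly5_var i = mon (\<lambda>j. if j = i then 1 else 0)"
  unfolding poly5_var_def
  by (intro arg_cong2[where f = single] poly_mapping_eqI) (auto simp: lookup_single when_def)

lemma poly5_var_power: "poly5_var i ^ n = mon (\<lambda>j. if j = i then n else 0)"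
  unfolding poly5_var_eq mon_power by (intro arg_cong2[where f = single] arg_cong[where f = expo]) auto

definition quintic :: "'k::field poly5" where
  "quintic = (\<Sum>i\<in>UNIV. poly5_var i ^ 5)"

lemma quintic_eq: "quintic = (\<Sum>i\<in>UNIV. mon (\<lambda>j. if j = i then 5 else 0))"
  by (simp add: quintic_def poly5_var_power)

section \<open>Characteristic two and the index type\<close>

lemma CHAR_poly_mapping [simp]: "CHAR('v::comm_monoid_add \<Rightarrow>\<^sub>0 'k::comm_semiring_1) = CHAR('k)"
proof (rule CHAR_eqI)
  fix n assume "of_nat n = (0 :: 'v \<Rightarrow>\<^sub>0 'k)"
  then have "lookup (of_nat n :: 'v \<Rightarrow>\<^sub>0 'k) 0 = 0" by simp
  then show "CHAR('k) dvd n" by (simp add: lookup_of_nat of_nat_eq_0_iff_char_dvd)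
next
  have "(of_nat CHAR('k) :: 'v \<Rightarrow>\<^sub>0 'k) = single 0 (of_nat CHAR('k))"
    by (rule single_of_nat[symmetric])
  then show "(of_nat CHAR('k) :: 'v \<Rightarrow>\<^sub>0 'k) = 0" by (simp only: of_nat_CHAR single_zero)
qed

lemma power_two_power_add:
  assumes "CHAR('r::comm_semiring_1) = 2"
  shows "((a :: 'r) + b) ^ (2 ^ n) = a ^ (2 ^ n) + b ^ (2 ^ n)"
  using freshmans_dream'[of "2 ^ n" n a b] assms by simp

lemma power_two_power_sum:
  assumes "CHAR('r::comm_semiring_1) = 2"
  shows "(\<Sum>i\<in>A. f i :: 'r) ^ (2 ^ n) = (\<Sum>i\<in>A. f i ^ (2 ^ n))"
  using freshmans_dream_sum'[of "2 ^ n" n f A] assms by simp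

lemma UNIV_5: "(UNIV :: 5 set) = {0, 1, 2, 3, 4}"
proof -
  have "card {0, 1, 2, 3, 4 :: 5} = CARD(5)" by simp
  then show ?thesis by (intro card_subset_eq[symmetric]) auto
qed

lemma exists_other_5: "\<exists>j :: 5. j \<noteq> a \<and> j \<noteq> b"
proof -
  have "card {a, b} < CARD(5)" by (cases "a = b") auto
  then show ?thesis by (metis (mono_tags) UNIV_eq_I insert_iff less_irrefl)
qed

section \<open>Inverse Frobenius maps\<close>

text \<open>\<open>l\<close> is linear from the field with scalars acting through their 2^e-th
  powers to the field with its usual structure. Over a perfect field, \<open>l b\<close> is
  \<open>l 1\<close> times the 2^e-th root of \<open>b\<close>.\<close>

locale inverse_frobenius =
  fixes l :: "'k::field \<Rightarrow> 'k" and e :: nat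
  assumes char_two: "CHAR('k) = 2"
    and l_add: "l (a + b) = l a + l b"
    and l_scale: "l (a ^ (2 ^ e) * b) = a * l b"
begin

lemma l_zero [simp]: "l 0 = 0"
  by (metis add.right_neutral add_left_cancel l_add)

text \<open>Split a polynomial by its exponents modulo 2^e: this is the coordinate of the residue
  vector \<open>r\<close>, with \<open>l\<close> applied to the coefficients.\<close>

definition froot :: "(5 \<Rightarrow> nat) \<Rightarrow> 'k poly5 \<Rightarrow> 'k poly5" where
  "froot r = additive_ext (\<lambda>v c. if \<forall>i. lookup v i mod 2 ^ e = r i
    then single (expo (\<lambda>i. lookup v i div 2 ^ e)) (l c) else 0)"

sublocale froot: additive_family "\<lambda>v c. if \<forall>i. lookup v i mod 2 ^ e = r i
    then single (expo (\<lambda>i. lookup v i div 2 ^ e)) (l c) else 0" for r :: "5 \<Rightarrow> nat"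
  by unfold_locales (auto simp: l_add single_add)

lemma froot_single: "froot r (single v c) = (if \<forall>i. lookup v i mod 2 ^ e = r i
    then single (expo (\<lambda>i. lookup v i div 2 ^ e)) (l c) else 0)"
  unfolding froot_def by (rule froot.ext_single)

lemma froot_zero [simp]: "froot r 0 = 0"
  unfolding froot_def by (rule froot.ext_zero)

lemma froot_add: "froot r (p + q) = froot r p + froot r q"
  unfolding froot_def by (rule froot.ext_add)

lemma froot_sum: "froot r (\<Sum>i\<in>A. f i) = (\<Sum>i\<in>A. froot r (f i))"
  unfolding froot_def by (rule froot.ext_sum)

text \<open>Taking 2^e-th powers is additive in characteristic 2, so terms suffice. Adding a
  multiple 2^e v to an exponent vector keeps its residues and adds v to its quotients.\<close>

lemma froot_scale: "froot r (h ^ (2 ^ e) * b) = h * froot r b"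
proof (induction h rule: additive_induct)
  case (single v c)
  show ?case
  proof (induction b rule: additive_induct)
    case (single w d)
    have "expo (\<lambda>i. lookup v i + lookup w i div 2 ^ e) = v + expo (\<lambda>i. lookup w i div 2 ^ e)"
      by (rule poly_mapping_eqI) (simp add: lookup_add)
    then show ?case
      by (simp add: single_power mult_single froot_single lookup_add l_scale)
  qed (auto simp: froot_add distrib_left)
next
  case (add a b)
  then show ?case
    by (simp add: power_two_power_add char_two froot_add distrib_right)
qed (simp add: zero_power)

end

text \<open>
  The field is a vector space over itself through the Frobenius action; it need not be perfect.
\<close>

lemma inverse_frobenius_exists:
  assumes char2: "CHAR('k::field) = 2" and \<alpha>: "(\<alpha> :: 'k) \<noteq> 0"
  obtains l where "inverse_frobenius l e" "l \<alpha> = 1"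
proof -
  interpret vector_space_pair "\<lambda>a b :: 'k. a ^ (2 ^ e) * b" "\<lambda>a b :: 'k. a * b"
    by unfold_locales
      (auto simp: algebra_simps power_two_power_add[OF char2] power_mult_distrib)
  have "vs1.independent {\<alpha>}"
    using \<alpha> by simp
  from linear_independent_extend[OF this, of "\<lambda>_. 1"] obtain l
    where l: "Vector_Spaces.linear (\<lambda>a b :: 'k. a ^ (2 ^ e) * b) (\<lambda>a b. a * b) l" "l \<alpha> = 1"
    by auto
  have "inverse_frobenius l e"
    by unfold_locales (use char2 l(1) linear_add linear_scale in auto)
  then show thesis using l(2) that by blast
qed

section \<open>Elimination of one variable\<close>

definition free0 :: "'k::field poly5 \<Rightarrow> bool" where
  "free0 a \<longleftrightarrow> (\<forall>v\<in>keys a. lookup v 0 = 0)"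

lemma free0_zero [simp]: "free0 0" and free0_one [simp]: "free0 1"
  by (auto simp: free0_def)

lemma free0_add: "free0 a \<Longrightarrow> free0 b \<Longrightarrow> free0 (a + b)"
  using keys_add[of a b] by (auto simp: free0_def)

lemma free0_mult: "free0 a \<Longrightarrow> free0 b \<Longrightarrow> free0 (a * b)"
  using keys_mult[of a b] by (fastforce simp: free0_def lookup_add)

lemma free0_sum: "(\<And>i. i \<in> A \<Longrightarrow> free0 (f i)) \<Longrightarrow> free0 (sum f A)"
  by (induction A rule: infinite_finite_induct) (auto simp: free0_add)

lemma free0_power: "free0 a \<Longrightarrow> free0 (a ^ n)"
  by (induction n) (auto simp: free0_mult)

text \<open>Polynomials in x_0 over the other variables. The coefficients stay in the five-variable
  ring; \<open>free0\<close> records that they do not involve x_0.\<close>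

definition as_poly :: "'k::field poly5 \<Rightarrow> 'k poly5 poly" where
  "as_poly = additive_ext (\<lambda>v c. monom (single (expo (\<lambda>i. if i = 0 then 0 else lookup v i)) c) (lookup v 0))"

interpretation as_poly: multiplicative_family
  "\<lambda>v (c::'k::field). monom (single (expo (\<lambda>i. if i = 0 then 0 else lookup v i)) c) (lookup v 0)"
proof
  fix v w :: "5 \<Rightarrow>\<^sub>0 nat" and a b :: 'k
  have "expo (\<lambda>i. if i = 0 then 0 else lookup (v + w) i) =
    expo (\<lambda>i. if i = 0 then 0 else lookup v i) + expo (\<lambda>i. if i = 0 then 0 else lookup w i)"
    by (rule poly_mapping_eqI) (simp add: lookup_add)
  then show "monom (single (expo (\<lambda>i. if i = 0 then 0 else lookup (v + w) i)) (a * b)) (lookup (v + w) 0) =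
    monom (single (expo (\<lambda>i. if i = 0 then 0 else lookup v i)) a) (lookup v 0) *
    monom (single (expo (\<lambda>i. if i = 0 then 0 else lookup w i)) b) (lookup w 0)"
    by (simp add: mult_monom mult_single lookup_add)
qed (auto simp: single_add add_monom expo_zero cong: if_cong)

lemmas as_poly_zero [simp] = as_poly.ext_zero[folded as_poly_def]
lemmas as_poly_add = as_poly.ext_add[folded as_poly_def]
lemmas as_poly_mult = as_poly.ext_mult[folded as_poly_def]
lemmas as_poly_power = as_poly.ext_power[folded as_poly_def]
lemmas as_poly_single = as_poly.ext_single[folded as_poly_def]

lemma as_poly_diff: "as_poly (a - b) = as_poly a - as_poly b"
  by (metis as_poly_add add_diff_cancel_right' diff_add_cancel)

lemma as_poly_var0: "as_poly (poly5_var 0) = monom 1 1"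
  by (simp add: poly5_var_eq as_poly_single expo_zero cong: if_cong)

lemma free0_coeff_as_poly: "free0 (coeff (as_poly z) i)"
proof (induction z rule: additive_induct)
  case (single v c)
  then show ?case by (auto simp: as_poly_single free0_def)
qed (auto simp: as_poly_add free0_add)

text \<open>Evaluation at x_0 reassembles the polynomial, which makes \<open>as_poly\<close>
  injective.\<close>

lemma poly_as_poly: "poly (as_poly z) (poly5_var 0) = z"
proof (induction z rule: additive_induct)
  case (single v c)
  have "expo (\<lambda>i. if i = 0 then 0 else lookup v i) + expo (\<lambda>i. if i = 0 then lookup v 0 else 0) = v"
    by (rule poly_mapping_eqI) (simp add: lookup_add)
  then show ?case
    by (simp add: as_poly_single poly_monom poly5_var_power mult_single)
qed (auto simp: as_poly_add)

lemma as_poly_eq_zero_iff [simp]: "as_poly z = 0 \<longleftrightarrow> z = 0"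
  by (metis as_poly_zero poly_0 poly_as_poly)

lemma as_poly_free0:
  assumes "free0 a"
  shows "as_poly a = [:a:]"
proof (rule additive_induct[where P = "\<lambda>x. as_poly x = [:x:]"])
  fix v and c :: 'a
  assume "v \<in> keys a"
  then have "expo (\<lambda>i. if i = 0 then 0 else lookup v i) = v" "lookup v 0 = 0"
    using assms by (auto simp: free0_def intro!: poly_mapping_eqI)
  then show "as_poly (single v c) = [:single v c:]"
    by (simp add: as_poly_single monom_0)
qed (auto simp: as_poly_add)

lemma free0_of_degree_zero:
  assumes "degree (as_poly z) = 0"
  shows "free0 z"
proof -
  obtain b where b: "as_poly z = [:b:]"
    using assms by (rule degree_eq_zeroE)
  then have "z = b" using poly_as_poly[of z] by simp
  with b show ?thesis using free0_coeff_as_poly[of z 0] by simp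
qed

section \<open>Pseudo-division and the Newton polygon in x_0\<close>

lemma pseudo_division:
  fixes e :: "'k::field poly5"
  defines "n \<equiv> degree (as_poly e)" and "l \<equiv> lead_coeff (as_poly e)"
  assumes n: "n > 0"
  shows "\<exists>k Q r. l ^ k * z = e * Q + r \<and> degree (as_poly r) < n"
proof (induction "degree (as_poly z)" arbitrary: z rule: less_induct)
  case less
  show ?case
  proof (cases "degree (as_poly z) < n")
    case True
    then have "l ^ 0 * z = e * 0 + z \<and> degree (as_poly z) < n" by simp
    then show ?thesis by blast
  next
    case False
    define d where "d = degree (as_poly z)"
    define b where "b = lead_coeff (as_poly z)"
    \<comment> \<open>The leading coefficient \<open>l\<close> need not be a unit, so
      \<open>z\<close> is multiplied by it before its leading term is cancelled; these factors
      accumulate in l^k.\<close>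
    define z' where "z' = l * z - b * poly5_var 0 ^ (d - n) * e"
    have dn: "d \<ge> n" using False by (simp add: d_def)
    have l: "as_poly l = [:l:]" and b: "as_poly b = [:b:]"
      unfolding l_def b_def by (auto intro!: as_poly_free0 free0_coeff_as_poly)
    have z': "as_poly z' = smult l (as_poly z) - smult b (monom 1 (d - n) * as_poly e)"
      by (simp add: z'_def as_poly_diff as_poly_mult as_poly_power l b as_poly_var0 monom_power)
    have "degree (as_poly z') \<le> d"
    proof (rule degree_le, intro allI impI)
      fix i assume "i > d"
      then show "coeff (as_poly z') i = 0"
        using dn by (auto simp: z' coeff_monom_mult coeff_eq_0 d_def n_def)
    qed
    moreover have "coeff (monom 1 (d - n) * as_poly e) d = l" "coeff (as_poly z) d = b"
      using dn by (simp_all add: coeff_monom_mult l_def n_def b_def d_def)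
    then have "coeff (as_poly z') d = 0"
      by (simp add: z')
    \<comment> \<open>A vanishing \<open>z'\<close> has degree 0, which is still below
      \<open>d\<close> because d \<ge> n > 0.\<close>
    ultimately have "degree (as_poly z') < d"
      using n dn by (metis coeff_0_degree_minus_1 diff_less le_neq_implies_less less_le_trans
          zero_less_one le_degree leading_coeff_0_iff degree_0 neq0_conv)
    from less[OF this[unfolded d_def]] obtain k Q r
      where "l ^ k * z' = e * Q + r" "degree (as_poly r) < n" by blast
    then have "l ^ Suc k * z = e * (Q + l ^ k * b * poly5_var 0 ^ (d - n)) + r \<and> degree (as_poly r) < n"
      by (simp add: z'_def algebra_simps)
    then show ?thesis by blast
  qed
qed

text \<open>As 4 is invertible modulo 5, the weights at two different indices below 5 are never
  equal, so the maximum is attained only once.\<close>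

lemma weight_max:
  fixes p :: "'a::zero poly" and \<delta> :: "'a \<Rightarrow> nat"
  assumes "p \<noteq> 0" "degree p < 5"
  obtains i where "coeff p i \<noteq> 0"
    "\<And>j. coeff p j \<noteq> 0 \<Longrightarrow> j \<noteq> i \<Longrightarrow> 5 * \<delta> (coeff p j) + 4 * j < 5 * \<delta> (coeff p i) + 4 * i"
proof -
  define w where "w i = 5 * \<delta> (coeff p i) + 4 * i" for i
  define S where "S = {i. coeff p i \<noteq> 0}"
  have S: "S \<subseteq> {..degree p}" by (auto simp: S_def le_degree)
  then have fin: "finite S" by (rule finite_subset) simp
  have ne: "S \<noteq> {}" using assms(1) by (auto simp: S_def poly_eq_iff)
  have "Max (w ` S) \<in> w ` S" using fin ne by simp
  then obtain i where i: "i \<in> S" "w i = Max (w ` S)" by force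
  then have i_max: "\<And>j. j \<in> S \<Longrightarrow> w j \<le> w i" using fin by simp
  show thesis
  proof (rule that[of i])
    show "coeff p i \<noteq> 0" using i(1) by (simp add: S_def)
    fix j assume "coeff p j \<noteq> 0" "j \<noteq> i"
    then have "j \<in> S" by (simp add: S_def)
    with S i(1) assms(2) have "j < 5" "i < 5" by auto
    have "j = i" if "5 * x + 4 * j = 5 * y + 4 * i" for x y :: nat
      using that \<open>j < 5\<close> \<open>i < 5\<close> by presburger
    then have "w j \<noteq> w i" using \<open>j \<noteq> i\<close> by (auto simp: w_def)
    with i_max[OF \<open>j \<in> S\<close>] show "5 * \<delta> (coeff p j) + 4 * j < 5 * \<delta> (coeff p i) + 4 * i"
      by (simp add: w_def)
  qed
qed

text \<open>
  The Newton polygon of \<open>T\<^sup>5 + g\<close> with respect to \<open>\<delta>\<close> is the single edge from \<open>(0, 4)\<close> to \<open>(5, 0)\<close>, which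
  contains no other lattice point. The weight \<open>5 \<delta> + 4 i\<close> is constant on this edge, whereas a
  product of two polynomials of smaller degree attains its maximal weight only once.
\<close>

lemma newton_polygon:
  fixes E Q :: "'a::idom poly" and \<delta> :: "'a \<Rightarrow> nat"
  assumes \<delta>_mult: "\<And>a b. a \<noteq> 0 \<Longrightarrow> b \<noteq> 0 \<Longrightarrow> \<delta> (a * b) = \<delta> a + \<delta> b"
    and \<delta>_add: "\<And>a b. \<delta> (a + b) \<le> max (\<delta> a) (\<delta> b)"
    and \<delta>_minus: "\<And>a. \<delta> (- a) = \<delta> a"
    and EQ: "E * Q = smult b (monom 1 5 + [:g:])"
    and b: "b \<noteq> 0" and g: "g \<noteq> 0" "\<delta> g = 4"
    and deg: "0 < degree E" "degree E < 5"
  shows False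
proof -
  have EQ_coeff: "coeff (E * Q) s = b * ((if s = 5 then 1 else 0) + (if s = 0 then g else 0))" for s
    by (auto simp: EQ coeff_pCons split: nat.splits)
  have "degree (monom 1 5 + [:g:]) = 5"
    by (subst degree_add_eq_left) (auto simp: degree_monom_eq)
  then have deg_EQ: "degree (E * Q) = 5" by (simp add: EQ b)
  then have "E \<noteq> 0" "Q \<noteq> 0" by auto
  then have degs: "degree E + degree Q = 5" using deg_EQ degree_mult_eq by metis
  define n m where "n = degree E" and "m = degree Q"
  have nm: "n + m = 5" "0 < n" "n < 5" "m < 5" using degs deg by (auto simp: n_def m_def)
  obtain i0 where i0: "coeff E i0 \<noteq> 0"
    and Ei: "\<And>j. coeff E j \<noteq> 0 \<Longrightarrow> j \<noteq> i0 \<Longrightarrow>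
      5 * \<delta> (coeff E j) + 4 * j < 5 * \<delta> (coeff E i0) + 4 * i0"
    using weight_max[OF \<open>E \<noteq> 0\<close> deg(2), of \<delta>] by metis
  obtain j0 where j0: "coeff Q j0 \<noteq> 0"
    and Qj: "\<And>j. coeff Q j \<noteq> 0 \<Longrightarrow> j \<noteq> j0 \<Longrightarrow>
      5 * \<delta> (coeff Q j) + 4 * j < 5 * \<delta> (coeff Q j0) + 4 * j0"
    using weight_max[OF \<open>Q \<noteq> 0\<close>, of \<delta>] nm by (metis m_def)
  \<comment> \<open>The ultrametric inequality for finite sums. Zero is kept apart because its
    \<delta> is not below \<open>d\<close> when \<open>d\<close> is 0.\<close>
  have small_sum: "sum h A = 0 \<or> \<delta> (sum h A) < d"
    if "finite A" "\<And>i. i \<in> A \<Longrightarrow> h i = 0 \<or> \<delta> (h i) < d" for h :: "nat \<Rightarrow> 'a" and A d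
    using that
  proof (induction A rule: finite_induct)
    case (insert x A)
    then have "h x = 0 \<or> \<delta> (h x) < d" "sum h A = 0 \<or> \<delta> (sum h A) < d" by auto
    then show ?case
      using \<delta>_add[of "h x" "sum h A"] insert.hyps by auto
  qed simp
  define s where "s = i0 + j0"
  \<comment> \<open>Only the pair (i0, j0) has maximal total weight. Among pairs with the same index
    sum its term thus has the strictly largest \<delta> and cannot be cancelled by the
    others.\<close>
  have "coeff (E * Q) s \<noteq> 0"
  proof
    let ?main = "coeff E i0 * coeff Q j0"
    let ?rest = "\<Sum>i\<in>{..s} - {i0}. coeff E i * coeff Q (s - i)"
    assume "coeff (E * Q) s = 0"
    moreover have "coeff (E * Q) s = ?main + ?rest"
      unfolding coeff_mult by (subst sum.remove[of _ i0]) (auto simp: s_def)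
    ultimately have main: "?main = - ?rest" by (simp add: eq_neg_iff_add_eq_0)
    have "?rest = 0 \<or> \<delta> ?rest < \<delta> ?main"
    proof (rule small_sum)
      fix i assume i: "i \<in> {..s} - {i0}"
      show "coeff E i * coeff Q (s - i) = 0 \<or> \<delta> (coeff E i * coeff Q (s - i)) < \<delta> ?main"
      proof (cases "coeff E i = 0 \<or> coeff Q (s - i) = 0")
        case False
        moreover have "s - i \<noteq> j0" using i by (auto simp: s_def)
        ultimately have "5 * \<delta> (coeff E i) + 4 * i < 5 * \<delta> (coeff E i0) + 4 * i0"
          "5 * \<delta> (coeff Q (s - i)) + 4 * (s - i) < 5 * \<delta> (coeff Q j0) + 4 * j0"
          using i Ei[of i] Qj[of "s - i"] by auto
        moreover have "i + (s - i) = i0 + j0" using i by (auto simp: s_def)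
        ultimately have "\<delta> (coeff E i) + \<delta> (coeff Q (s - i)) < \<delta> (coeff E i0) + \<delta> (coeff Q j0)"
          by linarith
        then show ?thesis using False i0 j0 by (simp add: \<delta>_mult)
      qed auto
    qed simp
    moreover have "?main \<noteq> 0" using i0 j0 by simp
    ultimately show False using main \<delta>_minus[of ?rest] by auto
  qed
  then have s: "s = 0 \<or> s = 5" by (auto simp: EQ_coeff split: if_splits)
  \<comment> \<open>The values of \<open>s\<close> leave only the index pairs (0, 0) and (n, m).
    Both have total weight 5 \<delta> b + 20, so neither is a unique maximum.\<close>
  have "b * g = coeff E 0 * coeff Q 0"
    using EQ_coeff[of 0] by (simp add: coeff_mult_0)
  moreover from this have "coeff E 0 \<noteq> 0" "coeff Q 0 \<noteq> 0" using b g(1) by auto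
  ultimately have d0: "\<delta> b + 4 = \<delta> (coeff E 0) + \<delta> (coeff Q 0)"
    using \<delta>_mult b g by metis
  have "coeff E n * coeff Q m = b"
    using EQ_coeff[of 5] nm(1) coeff_mult_degree_sum[of E Q] by (simp add: n_def m_def)
  moreover have En: "coeff E n \<noteq> 0" "coeff Q m \<noteq> 0"
    using \<open>E \<noteq> 0\<close> \<open>Q \<noteq> 0\<close> by (auto simp: n_def m_def)
  ultimately have d5: "\<delta> b = \<delta> (coeff E n) + \<delta> (coeff Q m)"
    using \<delta>_mult by metis
  have "i0 \<le> n" "j0 \<le> m" using i0 j0 by (auto simp: n_def m_def le_degree)
  from s show False
  proof
    assume "s = 0"
    then have "i0 = 0" "j0 = 0" by (auto simp: s_def)
    then have "5 * \<delta> (coeff E n) + 4 * n < 5 * \<delta> (coeff E 0)"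
      "5 * \<delta> (coeff Q m) + 4 * m \<le> 5 * \<delta> (coeff Q 0)"
      using Ei[OF En(1)] Qj[OF En(2)] nm by (auto simp: le_less)
    then show False using d0 d5 nm by linarith
  next
    assume "s = 5"
    then have "i0 = n" "j0 = m" using \<open>i0 \<le> n\<close> \<open>j0 \<le> m\<close> nm by (auto simp: s_def)
    then have "5 * \<delta> (coeff E 0) < 5 * \<delta> (coeff E n) + 4 * n"
      "5 * \<delta> (coeff Q 0) < 5 * \<delta> (coeff Q m) + 4 * m \<or> 5 * \<delta> (coeff Q 0) = 5 * \<delta> (coeff Q m) + 4 * m"
      using Ei[OF \<open>coeff E 0 \<noteq> 0\<close>] Qj[OF \<open>coeff Q 0 \<noteq> 0\<close>] nm by auto
    then show False using d0 d5 nm by linarith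
  qed
qed

text \<open>
  The substitution \<open>x\<^sub>1 \<mapsto> x\<^sub>1 + T\<close>, \<open>x\<^sub>2 \<mapsto> x\<^sub>2 + T\<close>: in characteristic \<open>2\<close> the two terms \<open>T\<^sup>5\<close>
  cancel in \<open>x\<^sub>1\<^sup>5 + x\<^sub>2\<^sup>5\<close>, which leaves the \<open>T\<close>-degree \<open>4\<close>, prime to \<open>5\<close>.
\<close>

definition shift :: "'k::field poly5 \<Rightarrow> 'k poly5 poly" where
  "shift = additive_ext (\<lambda>v c.
    [:single (expo (\<lambda>i. if i = 1 \<or> i = 2 then 0 else lookup v i)) c:] *
    [:poly5_var 1, 1:] ^ lookup v 1 * [:poly5_var 2, 1:] ^ lookup v 2)"

interpretation shift: multiplicative_family
  "\<lambda>v (c::'k::field). [:single (expo (\<lambda>i. if i = 1 \<or> i = 2 then 0 else lookup v i)) c:] *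
    [:poly5_var 1, 1:] ^ lookup v 1 * [:poly5_var 2, 1:] ^ lookup v 2"
proof
  fix v w :: "5 \<Rightarrow>\<^sub>0 nat" and a b :: 'k
  have "expo (\<lambda>i. if i = 1 \<or> i = 2 then 0 else lookup (v + w) i) =
    expo (\<lambda>i. if i = 1 \<or> i = 2 then 0 else lookup v i) + expo (\<lambda>i. if i = 1 \<or> i = 2 then 0 else lookup w i)"
    by (rule poly_mapping_eqI) (simp add: lookup_add)
  then have "[:single (expo (\<lambda>i. if i = 1 \<or> i = 2 then 0 else lookup (v + w) i)) (a * b):] =
     [:single (expo (\<lambda>i. if i = 1 \<or> i = 2 then 0 else lookup v i)) a:] *
     [:single (expo (\<lambda>i. if i = 1 \<or> i = 2 then 0 else lookup w i)) b:]"
    by (simp add: mult_single mult.commute add.commute)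
  then show "[:single (expo (\<lambda>i. if i = 1 \<or> i = 2 then 0 else lookup (v + w) i)) (a * b):] *
      [:poly5_var 1, 1:] ^ lookup (v + w) 1 * [:poly5_var 2, 1:] ^ lookup (v + w) 2 =
    [:single (expo (\<lambda>i. if i = 1 \<or> i = 2 then 0 else lookup v i)) a:] *
      [:poly5_var 1, 1:] ^ lookup v 1 * [:poly5_var 2, 1:] ^ lookup v 2 *
    ([:single (expo (\<lambda>i. if i = 1 \<or> i = 2 then 0 else lookup w i)) b:] *
      [:poly5_var 1, 1:] ^ lookup w 1 * [:poly5_var 2, 1:] ^ lookup w 2)"
    by (simp only: lookup_add power_add mult_ac)
next
  fix v :: "5 \<Rightarrow>\<^sub>0 nat" and a b :: 'k
  have "[:single (expo (\<lambda>i. if i = 1 \<or> i = 2 then 0 else lookup v i)) (a + b):] =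
     [:single (expo (\<lambda>i. if i = 1 \<or> i = 2 then 0 else lookup v i)) a:] +
     [:single (expo (\<lambda>i. if i = 1 \<or> i = 2 then 0 else lookup v i)) b:]"
    by (simp add: single_add)
  then show "[:single (expo (\<lambda>i. if i = 1 \<or> i = 2 then 0 else lookup v i)) (a + b):] *
      [:poly5_var 1, 1:] ^ lookup v 1 * [:poly5_var 2, 1:] ^ lookup v 2 =
    [:single (expo (\<lambda>i. if i = 1 \<or> i = 2 then 0 else lookup v i)) a:] *
      [:poly5_var 1, 1:] ^ lookup v 1 * [:poly5_var 2, 1:] ^ lookup v 2 +
    [:single (expo (\<lambda>i. if i = 1 \<or> i = 2 then 0 else lookup v i)) b:] *
      [:poly5_var 1, 1:] ^ lookup v 1 * [:poly5_var 2, 1:] ^ lookup v 2"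
    by (simp only: distrib_right)
qed (simp_all add: expo_zero cong: if_cong)

lemmas shift_zero [simp] = shift.ext_zero[folded shift_def]
lemmas shift_add = shift.ext_add[folded shift_def]
lemmas shift_mult = shift.ext_mult[folded shift_def]
lemmas shift_power = shift.ext_power[folded shift_def]
lemmas shift_single = shift.ext_single[folded shift_def]

text \<open>Setting T = 0 undoes the substitution, so \<open>shift\<close> is injective.\<close>

lemma poly_shift: "poly (shift z) 0 = z"
proof (induction z rule: additive_induct)
  case (single v c)
  have "expo (\<lambda>i. if i = 1 \<or> i = 2 then 0 else lookup v i) + expo (\<lambda>i. if i = 1 then lookup v 1 else 0) +
      expo (\<lambda>i. if i = 2 then lookup v 2 else 0) = v"
    by (rule poly_mapping_eqI) (simp add: lookup_add)
  then show ?case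
    by (simp add: shift_single poly5_var_power mult_single add.assoc)
qed (auto simp: shift_add)

lemma shift_eq_zero_iff [simp]: "shift z = 0 \<longleftrightarrow> z = 0"
  by (metis shift_zero poly_0 poly_shift)

lemma shift_var:
  "shift (poly5_var 1 :: 'k::field poly5) = [:poly5_var 1, 1:]"
  "shift (poly5_var 2 :: 'k poly5) = [:poly5_var 2, 1:]"
  "i \<noteq> 1 \<Longrightarrow> i \<noteq> 2 \<Longrightarrow> shift (poly5_var i :: 'k poly5) = [:poly5_var i:]"
proof -
  have shift: "shift (poly5_var k :: 'k poly5) = [:mon (\<lambda>j. if j = 1 \<or> j = 2 then 0 else if j = k then 1 else 0):] *
      [:poly5_var 1, 1:] ^ (if 1 = k then 1 else 0) * [:poly5_var 2, 1:] ^ (if 2 = k then 1 else 0)" for k :: 5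
    by (subst poly5_var_eq) (simp only: shift_single lookup_expo)
  have "(\<lambda>j::5. if j = 1 \<or> j = 2 then 0 else if j = k then 1 else 0) = (\<lambda>_. 0::nat)"
    if "k = 1 \<or> k = 2" for k
    using that by auto
  then have "mon (\<lambda>j. if j = 1 \<or> j = 2 then 0 else if j = k then 1 else 0) = (1 :: 'k poly5)"
    if "k = 1 \<or> k = 2" for k
    using that by (simp only: expo_zero single_one)
  from shift[of 1] shift[of 2] this[of 1] this[of 2]
  show "shift (poly5_var 1 :: 'k poly5) = [:poly5_var 1, 1:]"
    "shift (poly5_var 2 :: 'k poly5) = [:poly5_var 2, 1:]"
    by (simp_all only: refl simp_thms if_True if_False) simp_all
  assume i: "i \<noteq> 1" "i \<noteq> 2"
  then have "(\<lambda>j::5. if j = 1 \<or> j = 2 then 0 else if j = i then 1 else 0) = (\<lambda>j. if j = i then 1 else 0::nat)"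
    by auto
  then have "shift (poly5_var i :: 'k poly5) = [:mon (\<lambda>j. if j = i then 1 else 0):]"
    using i by (simp only: shift) simp
  then show "shift (poly5_var i :: 'k poly5) = [:poly5_var i:]"
    by (simp only: poly5_var_eq)
qed

section \<open>The quintic as a monic polynomial in x_0\<close>

definition quintic_tail :: "'k::field poly5" where
  "quintic_tail = (\<Sum>i\<in>-{0}. poly5_var i ^ 5)"

lemma quintic_split: "quintic = poly5_var 0 ^ 5 + quintic_tail"
  unfolding quintic_def quintic_tail_def
  by (subst sum.remove[of _ 0]) (auto intro!: sum.cong)

lemma free0_tail: "free0 quintic_tail"
  unfolding quintic_tail_def
  by (rule free0_sum) (auto simp: poly5_var_power free0_def)

lemma tail_eq: "quintic_tail = poly5_var 1 ^ 5 + poly5_var 2 ^ 5 + poly5_var 3 ^ 5 + poly5_var 4 ^ 5"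
proof -
  have "- {0 :: 5} = {1, 2, 3, 4}"
    using UNIV_5 by auto
  then show ?thesis by (simp add: quintic_tail_def add.assoc)
qed

lemma degree_shift_tail:
  assumes char2: "CHAR('k::field) = 2"
  shows "degree (shift (quintic_tail :: 'k poly5)) = 4"
proof -
  have "(2 :: 'k) = 0" using of_nat_CHAR[where 'a = 'k] char2 by simp
  then have two: "(2 :: 'k poly5) = 0"
    using of_nat_CHAR[where 'a = "'k poly5"] char2 by simp
  \<comment> \<open>In characteristic 2 the fourth power of a + T is a^4 + T^4; one more factor a +
    T gives the fifth.\<close>
  have lin: "[:a, 1:] ^ 5 = [:a ^ 5, a ^ 4, 0, 0, a, 1:]" for a :: "'k poly5"
  proof -
    have "CHAR('k poly5 poly) = 2" using char2 by simp
    from power_two_power_add[OF this, of "[:a:]" "[:0, 1:]" 2]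
    have "[:a, 1:] ^ 4 = [:a:] ^ 4 + [:0, 1:] ^ 4" by simp
    also have "\<dots> = [:a ^ 4, 0, 0, 0, 1:]"
      by (simp add: eval_nat_numeral mult_ac)
    finally have "[:a, 1:] ^ 4 = [:a ^ 4, 0, 0, 0, 1:]" .
    then have "[:a, 1:] * [:a, 1:] ^ 4 = [:a * a ^ 4, a ^ 4, 0, 0, a, 1:]" by simp
    moreover have "[:a, 1:] ^ 5 = [:a, 1:] * [:a, 1:] ^ 4" "a ^ 5 = a * a ^ 4"
      by (metis power_Suc eval_nat_numeral(3) semiring_norm(26))+
    ultimately show ?thesis by simp
  qed
  let ?x = "poly5_var :: 5 \<Rightarrow> 'k poly5"
  have "(1 + 1 :: 'k poly5) = 0" using two by simp
  then have "shift (quintic_tail :: 'k poly5) =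
    [:?x 1 ^ 5 + ?x 2 ^ 5 + ?x 3 ^ 5 + ?x 4 ^ 5, ?x 1 ^ 4 + ?x 2 ^ 4, 0, 0, ?x 1 + ?x 2:]"
    by (simp add: tail_eq shift_add shift_power shift_var lin poly_const_pow)
  \<comment> \<open>This is the coefficient of T^4, so the degree is exactly 4.\<close>
  moreover have "?x 1 + ?x 2 \<noteq> 0"
  proof
    assume "?x 1 + ?x 2 = 0"
    then have "lookup (?x 1 + ?x 2) (expo (\<lambda>j. if j = 1 then 1 else 0)) = 0" by simp
    then show False
      by (auto simp: lookup_add poly5_var_eq lookup_single when_def fun_eq_iff split: if_splits)
  qed
  ultimately show ?thesis by simp
qed

lemma as_poly_quintic: "as_poly quintic = monom 1 5 + [:quintic_tail:]"
  by (simp add: quintic_split as_poly_add as_poly_power as_poly_var0 monom_power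
      as_poly_free0 free0_tail)

lemma degree_as_poly_quintic: "degree (as_poly quintic) = 5"
  unfolding as_poly_quintic by (subst degree_add_eq_left) (auto simp: degree_monom_eq)

lemma lead_coeff_as_poly_quintic: "coeff (as_poly quintic) 5 = 1"
  by (simp add: as_poly_quintic coeff_pCons numeral_eq_Suc)

text \<open>F is monic in x_0, so pseudo-division by F is division with remainder.\<close>

lemma degree_residue_mod_quintic: "\<exists>t. degree (as_poly (z - quintic * t)) < 5"
proof -
  obtain k Q r where "coeff (as_poly quintic) 5 ^ k * z = quintic * Q + r" "degree (as_poly r) < 5"
    using pseudo_division[of quintic z] by (auto simp: degree_as_poly_quintic)
  then have "z - quintic * Q = r" by (simp add: lead_coeff_as_poly_quintic)
  with \<open>degree (as_poly r) < 5\<close> show ?thesis by blast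
qed

lemma degree_quintic_multiple:
  assumes "quintic * t \<noteq> 0"
  shows "degree (as_poly (quintic * t)) \<ge> 5"
  using assms by (simp add: as_poly_mult degree_mult_eq degree_as_poly_quintic flip: as_poly_eq_zero_iff)

text \<open>By \<open>newton_polygon\<close>, no multiple of F by a nonzero polynomial free of x_0
  has a factor of x_0-degree between 1 and 4. Hence the least x_0-degree of a nonzero element of (c,
  F) is 0.\<close>

lemma free0_multiple_mod_quintic:
  fixes c :: "'k::field poly5"
  assumes char2: "CHAR('k) = 2" and c: "\<not> quintic dvd c"
  obtains a h where "a \<noteq> 0" "free0 a" "quintic dvd c * h - a"
proof -
  \<comment> \<open>An element \<open>e\<close> of minimal degree in \<open>(c, F)\<close> pseudo-divides \<open>F\<close> without remainder.\<close>
  define M where "M z \<longleftrightarrow> z \<noteq> 0 \<and> (\<exists>h t. z = c * h + quintic * t)" for z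
  obtain t0 where t0: "degree (as_poly (c - quintic * t0)) < 5"
    using degree_residue_mod_quintic by blast
  have "c - quintic * t0 = c * 1 + quintic * (- t0)" by simp
  moreover have "c - quintic * t0 \<noteq> 0" using c by auto
  ultimately have M0: "M (c - quintic * t0)" unfolding M_def by blast
  define e where "e = arg_min (\<lambda>z. degree (as_poly z)) M"
  have e: "M e" and e_min: "\<And>z. M z \<Longrightarrow> degree (as_poly e) \<le> degree (as_poly z)"
    using arg_min_natI[of M, OF M0] arg_min_nat_le[of M] by (auto simp: e_def)
  have deg_e: "degree (as_poly e) < 5"
    using e_min[OF M0] t0 by linarith
  obtain h t where ht: "e = c * h + quintic * t" using e by (auto simp: M_def)
  show thesis
  proof (cases "degree (as_poly e) = 0")
    case True
    have "c * h - e = quintic * (- t)" by (simp add: ht)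
    then have "quintic dvd c * h - e" by (rule dvdI)
    then show thesis
      using that[of e h] e free0_of_degree_zero[OF True] by (auto simp: M_def)
  next
    case False
    define l where "l = lead_coeff (as_poly e)"
    obtain k Q r where r: "l ^ k * quintic = e * Q + r" "degree (as_poly r) < degree (as_poly e)"
      using pseudo_division[of e quintic] False by (auto simp: l_def)
    have "r = c * (- (h * Q)) + quintic * (l ^ k - t * Q)"
      using r(1) by (simp add: ht algebra_simps)
    then have "M r" if "r \<noteq> 0" using that unfolding M_def by blast
    then have "r = 0" using e_min[of r] r(2) by linarith
    have "as_poly l = [:l:]"
      unfolding l_def by (intro as_poly_free0 free0_coeff_as_poly)
    then have "as_poly e * as_poly Q = smult (l ^ k) (monom 1 5 + [:quintic_tail:])"
      using arg_cong[OF r(1), of as_poly]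
      by (simp add: \<open>r = 0\<close> as_poly_mult as_poly_power as_poly_quintic poly_const_pow)
    moreover have "l \<noteq> 0" using False by (auto simp: l_def)
    moreover have "degree (shift (quintic_tail :: 'k poly5)) = 4"
      using char2 by (rule degree_shift_tail)
    moreover have "shift (- a) = - shift a" for a :: "'k poly5"
      by (metis shift_add shift_zero add.right_inverse add_eq_0_iff)
    \<comment> \<open>Here \<delta> is the T-degree after \<open>shift\<close>: it is additive on
      products over a domain, and it equals 4 on the tail of F.\<close>
    ultimately have False
      using False deg_e
      by (intro newton_polygon[of "degree \<circ> shift" "as_poly e" "as_poly Q" "l ^ k" quintic_tail])
        (auto simp: shift_mult shift_add degree_mult_eq degree_add_le_max)
    then show thesis ..
  qed
qed

text \<open>If F does not divide \<open>b\<close>, some nonzero \<open>c\<close> free of x_0 is a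
  multiple of \<open>b\<close> modulo F, whence F divides c a. Reduce \<open>a\<close> to x_0-degree
  below 5: multiplication by \<open>c\<close> keeps the degree, and the only multiple of F of degree
  below 5 is 0.\<close>

lemma quintic_prime:
  fixes a b :: "'k::field poly5"
  assumes char2: "CHAR('k) = 2" and ab: "quintic dvd a * b"
  shows "quintic dvd a \<or> quintic dvd b"
proof (rule disjCI)
  assume "\<not> quintic dvd b"
  then obtain c h where c: "c \<noteq> 0" "free0 c" and h: "quintic dvd b * h - c"
    using free0_multiple_mod_quintic[OF char2] by metis
  obtain t where t: "degree (as_poly (a - quintic * t)) < 5"
    using degree_residue_mod_quintic by blast
  define r where "r = a - quintic * t"
  have "c * r = a * b * h - a * (b * h - c) - quintic * (t * c)"
    by (simp add: r_def algebra_simps)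
  then have "quintic dvd c * r" using ab h by simp
  then obtain s where s: "c * r = quintic * s" by (rule dvdE)
  have "degree (as_poly (c * r)) = degree (as_poly r)"
    using c by (simp add: as_poly_mult as_poly_free0)
  then have "c * r = 0"
    using degree_quintic_multiple[of s] s t by (auto simp: r_def)
  then have "a = quintic * t" using c(1) by (simp add: r_def)
  then show "quintic dvd a" by simp
qed

section \<open>Traces of multiples of powers of the quintic\<close>

lemma minus_eq_plus_char2:
  assumes "CHAR('r::comm_ring_1) = 2"
  shows "(a :: 'r) - b = a + b"
proof -
  have "b + b = 0"
    using of_nat_CHAR[where 'a = 'r] assms by (metis mult_2 mult_zero_left of_nat_numeral)
  then show ?thesis by (simp add: diff_eq_eq add.assoc)
qed

lemma quintic_nonzero: "quintic \<noteq> 0"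
  by (metis degree_as_poly_quintic as_poly_zero degree_0 zero_neq_numeral)

text \<open>With X = x_0^5 and Y the tail, F = X - Y and F^q = X^q - Y^q for q = 2^e in
  characteristic 2. The quotient is a geometric sum, free of binomial coefficients.\<close>

lemma quintic_power:
  assumes char2: "CHAR('k::field) = 2"
  shows "quintic ^ (2 ^ e - 1) = (\<Sum>j<2 ^ e. quintic_tail ^ (2 ^ e - Suc j) * (poly5_var 0 ^ 5) ^ j :: 'k poly5)"
proof -
  let ?x = "poly5_var 0 ^ 5 :: 'k poly5" and ?y = "quintic_tail :: 'k poly5"
  have char2': "CHAR('k poly5) = 2" using char2 by simp
  have "quintic * quintic ^ (2 ^ e - 1) = (quintic :: 'k poly5) ^ (2 ^ e)"
    by (subst power_Suc[symmetric]) simp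
  also have "\<dots> = (?x + ?y) ^ (2 ^ e)"
    by (simp only: quintic_split)
  also have "\<dots> = ?x ^ (2 ^ e) - ?y ^ (2 ^ e)"
    by (simp add: power_two_power_add[OF char2'] minus_eq_plus_char2[OF char2'])
  also have "\<dots> = quintic * (\<Sum>j<2 ^ e. ?y ^ (2 ^ e - Suc j) * ?x ^ j)"
    by (subst power_diff_sumr2) (simp only: minus_eq_plus_char2[OF char2'] quintic_split)
  finally show ?thesis by (simp only: mult_left_cancel[OF quintic_nonzero])
qed

context inverse_frobenius
begin

lemma froot_eq_zero:
  assumes "\<And>v. v \<in> keys p \<Longrightarrow> lookup v i mod 2 ^ e \<noteq> r i"
  shows "froot r p = 0"
  unfolding froot_def additive_ext_def using assms by (intro sum.neutral) auto

text \<open>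
  Since \<open>5\<close> is invertible modulo \<open>q\<close>, the chosen residue of the exponent of \<open>x\<^sub>0\<close> selects the
  single term \<open>x\<^sub>0\<^bsup>5(q-1)\<^esup>\<close> of \<open>F\<^bsup>q-1\<^esup>\<close>.
\<close>

lemma froot_quintic_power:
  assumes a: "free0 a" and v0: "v0 \<in> keys a" "l (lookup a v0) = 1"
    and e: "e \<ge> 3" "\<And>v i. v \<in> keys a \<Longrightarrow> lookup v i < 2 ^ e"
  shows "froot (\<lambda>i. lookup v0 i + (if i = 0 then 2 ^ e - 5 else 0)) (quintic ^ (2 ^ e - 1) * a) =
    mon (\<lambda>i. if i = 0 then 4 else 0)"
proof -
  define q :: nat where "q = 2 ^ e"
  define r where "r = (\<lambda>i. lookup v0 i + (if i = 0 then q - 5 else 0))"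
  let ?x = "poly5_var 0 :: 'k poly5"
  \<comment> \<open>The bound on \<open>e\<close> makes q - 5 an honest difference and a residue
    modulo q.\<close>
  have q8: "q \<ge> 8" using power_increasing[OF e(1), of "2::nat"] by (simp add: q_def)
  have v00: "lookup v0 0 = 0" using a v0 by (auto simp: free0_def)
  have vanish: "froot r (quintic_tail ^ (q - Suc j) * (?x ^ 5) ^ j * a) = 0" if j: "j < q - 1" for j
  proof (rule froot_eq_zero[of _ 0])
    define b where "b = quintic_tail ^ (q - Suc j) * a"
    have b: "free0 b" unfolding b_def by (intro free0_mult free0_power free0_tail a)
    fix v assume "v \<in> keys (quintic_tail ^ (q - Suc j) * (?x ^ 5) ^ j * a)"
    also have "quintic_tail ^ (q - Suc j) * (?x ^ 5) ^ j * a = ?x ^ (5 * j) * b"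
      by (simp add: b_def mult_ac flip: power_mult)
    finally have "lookup v 0 = 5 * j"
      using keys_mult[of "?x ^ (5 * j)" b] b by (auto simp: poly5_var_power free0_def lookup_add)
    show "lookup v 0 mod 2 ^ e \<noteq> r 0"
    proof
      assume "lookup v 0 mod 2 ^ e = r 0"
      then have "(5 * j) mod q = q - 5"
        using v00 \<open>lookup v 0 = 5 * j\<close> by (simp add: r_def q_def)
      also have "\<dots> = (q - 5) mod q" using q8 by simp
      also have "\<dots> = (4 * q + (q - 5)) mod q" by simp
      also have "4 * q + (q - 5) = 5 * (q - 1)" using q8 by simp
      finally have "(5 * (q - 1)) mod q = (5 * j) mod q" by (rule sym)
      moreover have "5 * j \<le> 5 * (q - 1)" using j by simp
      ultimately have "q dvd 5 * (q - 1) - 5 * j" by (simp only: mod_eq_dvd_iff_nat)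
      also have "5 * (q - 1) - 5 * j = 5 * (q - 1 - j)" by (rule diff_mult_distrib2[symmetric])
      finally have "q dvd 5 * (q - 1 - j)" .
      moreover have "coprime q 5" unfolding q_def by simp
      ultimately have "q dvd q - 1 - j" by (simp add: coprime_dvd_mult_right_iff)
      then show False using j q8 by (auto dest: dvd_imp_le)
    qed
  qed
  have "froot r (quintic ^ (q - 1) * a) = (\<Sum>j<q. froot r (quintic_tail ^ (q - Suc j) * (?x ^ 5) ^ j * a))"
    unfolding q_def quintic_power[OF char_two] sum_distrib_right froot_sum ..
  also have "\<dots> = (\<Sum>j<q. if j = q - 1 then froot r ((?x ^ 5) ^ (q - 1) * a) else 0)"
    using q8 by (intro sum.cong) (auto simp: vanish)
  also have "\<dots> = froot r ((?x ^ 5) ^ (q - 1) * a)"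
    using q8 by simp
  \<comment> \<open>Since 5(q - 1) = 4q + (q - 5), the trace extracts x_0^(4q) as x_0^4 and leaves
    residue q - 5.\<close>
  also have "(?x ^ 5) ^ (q - 1) * a = (?x ^ 4) ^ (2 ^ e) * (?x ^ (q - 5) * a)"
  proof -
    have "5 * (q - 1) = 4 * q + (q - 5)" using q8 by simp
    then show ?thesis by (simp add: q_def mult.assoc flip: power_mult power_add)
  qed
  also have "froot r \<dots> = ?x ^ 4 * froot r (?x ^ (q - 5) * a)"
    by (rule froot_scale)
  \<comment> \<open>All exponents are now below q, so residues determine them: exactly the term of
    \<open>v0\<close> survives, with quotient exponents 0 and coefficient normalized by
    \<open>l\<close>.\<close>
  also have "froot r (?x ^ (q - 5) * a) = 1"
  proof -
    let ?w = "expo (\<lambda>i. if i = 0 then q - 5 else 0)"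
    have "?x ^ (q - 5) * a = ?x ^ (q - 5) * (\<Sum>v\<in>keys a. single v (lookup a v))"
      by (simp only: sum_single_keys)
    also have "\<dots> = (\<Sum>v\<in>keys a. single (?w + v) (lookup a v))"
      by (simp add: sum_distrib_left poly5_var_power mult_single)
    finally have "froot r (?x ^ (q - 5) * a) = (\<Sum>v\<in>keys a. froot r (single (?w + v) (lookup a v)))"
      by (simp add: froot_sum)
    also have "\<dots> = (\<Sum>v\<in>keys a. if v = v0 then 1 else 0)"
    proof (intro sum.cong refl)
      fix v assume v: "v \<in> keys a"
      then have v_lt: "lookup v i < q" "lookup v 0 = 0" for i
        using e(2) a by (auto simp: free0_def q_def)
      then have lt: "lookup (?w + v) i < q" for i using q8 by (simp add: lookup_add)
      then have div: "(\<lambda>i. lookup (?w + v) i div 2 ^ e) = (\<lambda>_. 0)" by (simp add: q_def)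
      from lt have "(\<forall>i. lookup (?w + v) i mod 2 ^ e = r i) \<longleftrightarrow> (\<forall>i. lookup (?w + v) i = r i)"
        by (simp add: q_def)
      also have "\<dots> \<longleftrightarrow> v = v0"
        using v_lt v00 by (auto simp: r_def lookup_add poly_mapping_eq_iff fun_eq_iff)
      finally have "froot r (single (?w + v) (lookup a v)) =
        (if v = v0 then single (expo (\<lambda>i. 0)) (l (lookup a v)) else 0)"
        by (simp only: froot_single div)
      then show "froot r (single (?w + v) (lookup a v)) = (if v = v0 then 1 else 0)"
        using v0 by (simp add: expo_zero)
    qed
    also have "\<dots> = 1" using v0 by simp
    finally show ?thesis .
  qed
  finally show ?thesis
    unfolding r_def q_def poly5_var_power mult_1_right .
qed

text \<open>The five monomials of F x^a have pairwise different parity vectors, since adding 5 flips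
  the parity of one coordinate. Prescribing parities therefore isolates one of them.\<close>

lemma froot_quintic_mon:
  assumes "e = 1" "l 1 = 1"
  defines "b \<equiv> (\<lambda>a j k. a k + (if k = j then 5 else 0 :: nat))"
  shows "froot (\<lambda>k. b a i k mod 2) (quintic * mon a) = mon (\<lambda>k. b a i k div 2)"
proof -
  have "quintic * (mon a :: 'k poly5) = (\<Sum>j\<in>UNIV. mon (b a j))"
    by (simp add: quintic_eq sum_distrib_right mon_mult b_def add.commute)
  then have "froot (\<lambda>k. b a i k mod 2) (quintic * mon a) =
    (\<Sum>j\<in>UNIV. froot (\<lambda>k. b a i k mod 2) (mon (b a j)))"
    by (simp add: froot_sum)
  also have "\<dots> = (\<Sum>j\<in>UNIV. if j = i then mon (\<lambda>k. b a i k div 2) else 0)"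
  proof (intro sum.cong refl)
    fix j
    have "b a j j mod 2 \<noteq> b a i j mod 2" if "j \<noteq> i"
      using that unfolding b_def by simp presburger
    then show "froot (\<lambda>k. b a i k mod 2) (mon (b a j)) =
      (if j = i then mon (\<lambda>k. b a i k div 2) else 0)"
      by (subst froot_single) (use assms(1,2) in auto)
  qed
  finally show ?thesis by simp
qed

end

lemma froot_quintic_power_exists:
  fixes a :: "'k::field poly5"
  assumes char2: "CHAR('k) = 2" and a: "a \<noteq> 0" "free0 a"
  shows "\<exists>e\<ge>e0. \<exists>l r. inverse_frobenius l e \<and>
    inverse_frobenius.froot l e r (quintic ^ (2 ^ e - 1) * a) = mon (\<lambda>i. if i = 0 then 4 else 0)"
proof -
  obtain v0 where v0: "v0 \<in> keys a"
    using a(1) by (metis sum_single_keys sum.empty ex_in_conv)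
  \<comment> \<open>A crude bound for all exponents of \<open>a\<close>; since N < 2^N, any e \<ge>
    N puts them below 2^e.\<close>
  define N where "N = (\<Sum>v\<in>keys a. \<Sum>i\<in>UNIV. lookup v i)"
  define e where "e = max e0 (max 3 N)"
  have bound: "lookup v i < 2 ^ e" if "v \<in> keys a" for v i
  proof -
    have "lookup v i \<le> (\<Sum>i\<in>UNIV. lookup v i)" by (rule member_le_sum) auto
    also have "\<dots> \<le> N" unfolding N_def by (rule member_le_sum) (use that in auto)
    also have "\<dots> < 2 ^ N" by (rule less_exp)
    also have "\<dots> \<le> 2 ^ e" by (rule power_increasing) (auto simp: e_def)
    finally show ?thesis .
  qed
  obtain l where l: "inverse_frobenius l e" "l (lookup a v0) = 1"
    using inverse_frobenius_exists[OF char2, of "lookup a v0"] v0 by (metis in_keys_iff)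
  have "inverse_frobenius.froot l e (\<lambda>i. lookup v0 i + (if i = 0 then 2 ^ e - 5 else 0))
      (quintic ^ (2 ^ e - 1) * a) = mon (\<lambda>i. if i = 0 then 4 else 0)"
    by (rule inverse_frobenius.froot_quintic_power[OF l(1) a(2) v0 l(2) _ bound]) (simp add: e_def)
  moreover have "e \<ge> e0" by (simp add: e_def)
  ultimately show ?thesis using l(1) by blast
qed

section \<open>Fractions of polynomials\<close>

lemma (in cring) idealI_cring:
  assumes "I \<subseteq> carrier R" "\<zero> \<in> I" "\<And>x y. x \<in> I \<Longrightarrow> y \<in> I \<Longrightarrow> x \<oplus> y \<in> I"
    and mult: "\<And>r x. r \<in> carrier R \<Longrightarrow> x \<in> I \<Longrightarrow> r \<otimes> x \<in> I"
  shows "ideal I R"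
proof (rule idealI)
  show "subgroup I (add_monoid R)"
  proof (rule subgroup.intro)
    fix x assume "x \<in> I"
    then have "(\<ominus> \<one>) \<otimes> x \<in> I" "x \<in> carrier R" using assms(1) by (auto intro!: mult)
    then have "\<ominus> x \<in> I" by (simp add: l_minus)
    then show "inv\<^bsub>add_monoid R\<^esub> x \<in> I" by (simp add: a_inv_def)
  qed (use assms in auto)
  fix r x assume "x \<in> I" "r \<in> carrier R"
  then show "r \<otimes> x \<in> I" "x \<otimes> r \<in> I" using mult[of r x] assms(1) m_comm[of x r] by auto
qed (rule ring_axioms)

section \<open>Residue classes modulo the quintic\<close>

lemma poly5_ring_simps [simp]:
  "carrier poly5_ring = UNIV" "a \<otimes>\<^bsub>poly5_ring\<^esub> b = a * b" "a \<oplus>\<^bsub>poly5_ring\<^esub> b = a + b"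
  "\<one>\<^bsub>poly5_ring\<^esub> = 1" "\<zero>\<^bsub>poly5_ring\<^esub> = 0"
  by (simp_all add: poly5_ring_def)

lemma quintic_ideal_eq: "quintic_ideal = {a. quintic dvd a}"
proof -
  interpret cring "poly5_ring :: 'a poly5 ring" by (rule cring_poly5_ring)
  have "quintic_ideal = PIdl\<^bsub>poly5_ring\<^esub> (quintic :: 'a poly5)"
    by (simp add: quintic_ideal_def cgenideal_eq_genideal flip: quintic_def)
  then show ?thesis by (auto simp: cgenideal_def dvd_def mult.commute)
qed

lemma ideal_quintic_ideal: "ideal quintic_ideal poly5_ring"
proof -
  interpret cring "poly5_ring :: 'a poly5 ring" by (rule cring_poly5_ring)
  show ?thesis unfolding quintic_ideal_def by (rule genideal_ideal) simp
qed

definition residue :: "'k::field poly5 \<Rightarrow> 'k poly5 set" where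
  "residue a = quintic_ideal +>\<^bsub>poly5_ring\<^esub> a"

lemma residue_eq: "residue a = {x. quintic dvd x - a}"
proof -
  have "x \<in> residue a \<longleftrightarrow> quintic dvd x - a" for x
    by (auto simp: residue_def a_r_coset_def' quintic_ideal_eq intro!: exI[of _ "x - a"])
  then show ?thesis by blast
qed

lemma residue_eq_iff: "residue a = residue b \<longleftrightarrow> quintic dvd a - b"
proof
  assume "residue a = residue b"
  moreover have "a \<in> residue a" by (simp add: residue_eq)
  ultimately show "quintic dvd a - b" by (simp add: residue_eq)
next
  assume ab: "quintic dvd a - b"
  have "quintic dvd x - a \<longleftrightarrow> quintic dvd x - b" for x
  proof -
    have "x - b = (x - a) + (a - b)" by simp
    then show ?thesis using ab by (metis dvd_add_left_iff)
  qed
  then show "residue a = residue b" by (auto simp: residue_eq)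
qed

lemma carrier_quintic_quot: "carrier quintic_quot = range residue"
  by (auto simp: quintic_quot_def FactRing_def A_RCOSETS_def' residue_def)

lemma cring_quintic_quot: "cring quintic_quot"
  unfolding quintic_quot_def
  by (rule ideal.quotient_is_cring[OF ideal_quintic_ideal cring_poly5_ring])

lemma residue_hom: "residue \<in> ring_hom poly5_ring quintic_quot"
  using ideal.rcos_ring_hom[OF ideal_quintic_ideal]
  by (simp add: quintic_quot_def residue_def[abs_def])

lemma residue_mult: "residue a \<otimes>\<^bsub>quintic_quot\<^esub> residue b = residue (a * b)"
  using ring_hom_mult[OF residue_hom, of a b] by simp

lemma residue_add: "residue a \<oplus>\<^bsub>quintic_quot\<^esub> residue b = residue (a + b)"
  using ring_hom_add[OF residue_hom, of a b] by simp

lemma residue_one: "\<one>\<^bsub>quintic_quot\<^esub> = residue 1"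
  by (rule ring_hom_one[OF residue_hom, simplified, symmetric])

lemma residue_zero: "\<zero>\<^bsub>quintic_quot\<^esub> = residue 0"
  by (auto simp: quintic_quot_def FactRing_def residue_eq quintic_ideal_eq)

section \<open>Constant terms and the ideal of the origin\<close>

lemma lookup_mult_zero: "lookup (a * b) 0 = lookup a 0 * lookup (b :: 'k::field poly5) 0"
proof (induction a rule: additive_induct)
  case (single v c)
  show ?case
  proof (induction b rule: additive_induct)
    case (single w d)
    have "v + w = 0 \<longleftrightarrow> v = 0 \<and> w = 0"
      by (auto simp: poly_mapping_eq_iff fun_eq_iff lookup_add)
    then show ?case by (auto simp: mult_single lookup_single when_def)
  qed (auto simp: lookup_add algebra_simps)
qed (auto simp: lookup_add algebra_simps)

lemma lookup_power_zero: "lookup (a ^ n) 0 = lookup (a :: 'k::field poly5) 0 ^ n"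
  by (induction n) (auto simp: lookup_mult_zero)

lemma lookup_quintic_zero: "lookup quintic 0 = 0"
proof -
  have "expo (\<lambda>j. if j = i then 5 else 0) \<noteq> 0" for i :: 5
    by (simp add: poly_mapping_eq_iff fun_eq_iff)
  then show ?thesis
    by (auto simp: quintic_eq lookup_sum lookup_single when_def intro!: sum.neutral)
qed

lemma quintic_dvd_lookup_zero: "quintic dvd a \<Longrightarrow> lookup a 0 = 0"
  by (auto simp: lookup_mult_zero lookup_quintic_zero elim!: dvdE)

lemma residue_eq_lookup_zero: "residue a = residue b \<Longrightarrow> lookup a 0 = lookup b 0"
  using quintic_dvd_lookup_zero[of "a - b"] by (simp add: residue_eq_iff lookup_minus)

lemma quot_var_eq: "quot_var i = residue (poly5_var i)"
  by (simp add: quot_var_def residue_def)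

lemma lookup_poly5_var_zero: "lookup (poly5_var i) 0 = 0"
proof -
  have "single i (1::nat) \<noteq> 0" by (metis lookup_single_eq lookup_zero zero_neq_one)
  then show ?thesis by (simp add: poly5_var_def lookup_single when_def)
qed

text \<open>F has no constant term, so constant terms are well defined on residue classes.
  Conversely, every monomial other than 1 is divisible by a variable.\<close>

lemma residue_in_origin_iff: "residue a \<in> quot_origin \<longleftrightarrow> lookup (a :: 'k::field poly5) 0 = 0"
proof -
  interpret Q: cring "quintic_quot :: 'k poly5 set ring" by (rule cring_quintic_quot)
  have vars: "range quot_var \<subseteq> carrier (quintic_quot :: 'k poly5 set ring)"
    by (auto simp: quot_var_eq carrier_quintic_quot)
  interpret O: ideal quot_origin "quintic_quot :: 'k poly5 set ring"
    unfolding quot_origin_def by (rule Q.genideal_ideal[OF vars])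
  let ?K = "residue ` {a :: 'k poly5. lookup a 0 = 0}"
  have "quot_origin \<subseteq> ?K"
    unfolding quot_origin_def
  proof (rule Q.genideal_minimal)
    show "ideal ?K quintic_quot"
      by (rule Q.idealI_cring)
        (auto simp: carrier_quintic_quot residue_zero residue_add residue_mult lookup_mult_zero
          lookup_add intro!: imageI)
    show "range quot_var \<subseteq> ?K"
      by (auto simp: quot_var_eq lookup_poly5_var_zero)
  qed
  then have "lookup a 0 = 0" if "residue a \<in> quot_origin"
  proof -
    have "residue a \<in> ?K" using \<open>quot_origin \<subseteq> ?K\<close> that by (rule subsetD)
    then show ?thesis by (auto dest: residue_eq_lookup_zero)
  qed
  moreover have "residue a \<in> quot_origin" if "lookup a 0 = 0"
  proof (rule additive_induct[where P = "\<lambda>x. residue x \<in> quot_origin" and p = a])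
    show "residue 0 \<in> (quot_origin :: 'k poly5 set set)"
      by (subst residue_zero[symmetric]) (rule O.zero_closed)
    show "residue (x + y) \<in> quot_origin" if "residue x \<in> quot_origin" "residue y \<in> quot_origin" for x y :: "'k poly5"
      using O.a_closed[OF that] by (simp add: residue_add)
    fix v and c :: 'k
    assume "v \<in> keys a"
    with that have "v \<noteq> 0" by (auto simp: in_keys_iff)
    then obtain i where i: "lookup v i \<noteq> 0" by (auto simp: poly_mapping_eq_iff fun_eq_iff)
    have "expo (\<lambda>j. if j = i then lookup v j - 1 else lookup v j) + expo (\<lambda>j. if j = i then 1 else 0) = v"
      using i by (intro poly_mapping_eqI) (auto simp: lookup_add)
    then have v: "single v c = single (expo (\<lambda>j. if j = i then lookup v j - 1 else lookup v j)) c * poly5_var i"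
      by (simp add: poly5_var_eq mult_single)
    have "quot_var i \<in> (quot_origin :: 'k poly5 set set)"
      unfolding quot_origin_def using Q.genideal_self[OF vars] by blast
    then show "residue (single v c) \<in> quot_origin"
      unfolding v residue_mult[symmetric]
      by (intro O.I_l_closed) (simp_all only: quot_var_eq[symmetric] carrier_quintic_quot rangeI)
  qed
  ultimately show ?thesis by (rule iffI)
qed

section \<open>The local ring as fractions of polynomials\<close>

lemma mult_subset_origin:
  "mult_subset (quintic_quot :: 'k::field poly5 set ring) (carrier quintic_quot - quot_origin)"
proof -
  interpret Q: cring "quintic_quot :: 'k poly5 set ring" by (rule cring_quintic_quot)
  show ?thesis
    by unfold_locales
      (auto simp: carrier_quintic_quot residue_mult residue_in_origin_iff lookup_mult_zero residue_one)
qed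

definition qfrac :: "'k::field poly5 \<Rightarrow> 'k poly5 \<Rightarrow> 'k quintic_elem" where
  "qfrac a s = fraction quintic_quot (carrier quintic_quot - quot_origin) (residue a) (residue s)"

lemma quintic_var_eq: "quintic_var i = qfrac (poly5_var i) 1"
  by (simp add: quintic_var_def qfrac_def quot_var_def residue_one residue_def)

lemma residue_in_complement:
  "residue s \<in> carrier quintic_quot - quot_origin \<longleftrightarrow> lookup s 0 \<noteq> 0"
  by (auto simp: carrier_quintic_quot residue_in_origin_iff)

lemma residue_in_carrier: "residue a \<in> carrier quintic_quot"
  by (auto simp: carrier_quintic_quot)

lemma carrier_quintic_ring:
  "carrier quintic_ring = {qfrac a s | a s. lookup s (0 :: 5 \<Rightarrow>\<^sub>0 nat) \<noteq> (0 :: 'k::field)}"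
proof -
  interpret mult_subset "quintic_quot :: 'k poly5 set ring" "carrier quintic_quot - quot_origin"
    by (rule mult_subset_origin)
  show ?thesis
  proof (intro equalityI subsetI)
    fix X :: "'k quintic_elem" assume "X \<in> carrier quintic_ring"
    then obtain A S where *: "A \<in> carrier quintic_quot" "S \<in> carrier quintic_quot - quot_origin"
      "X = fraction quintic_quot (carrier quintic_quot - quot_origin) A S"
      unfolding quintic_ring_def by (rule localization_cases)
    then obtain a s where "A = residue a" "S = residue s" by (auto simp: carrier_quintic_quot)
    with * show "X \<in> {qfrac a s | a s. lookup s 0 \<noteq> 0}"
      by (auto simp: qfrac_def residue_in_origin_iff)
  next
    fix X :: "'k quintic_elem" assume "X \<in> {qfrac a s | a s. lookup s 0 \<noteq> 0}"
    then obtain a s where "X = qfrac a s" "lookup s 0 \<noteq> 0" by blast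
    then show "X \<in> carrier quintic_ring"
      unfolding quintic_ring_def
      by (simp only: qfrac_def) (intro fraction_carrier, simp_all only: residue_in_complement residue_in_carrier not_False_eq_True)
  qed
qed

lemma qfrac_in_carrier [simp]: "lookup s 0 \<noteq> 0 \<Longrightarrow> qfrac a s \<in> carrier quintic_ring"
  by (auto simp: carrier_quintic_ring)

lemma cring_quintic_ring: "cring quintic_ring"
  unfolding quintic_ring_def by (rule mult_subset.cring_localization[OF mult_subset_origin])

lemma qfrac_mult:
  "lookup s 0 \<noteq> 0 \<Longrightarrow> lookup t 0 \<noteq> 0 \<Longrightarrow> qfrac a s \<otimes>\<^bsub>quintic_ring\<^esub> qfrac b t = qfrac (a * b) (s * t)"
  unfolding quintic_ring_def qfrac_def
  by (subst mult_subset.localization_mult[OF mult_subset_origin])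
    (auto simp: residue_in_complement residue_in_carrier residue_in_origin_iff residue_mult)

lemma qfrac_add:
  "lookup s 0 \<noteq> 0 \<Longrightarrow> lookup t 0 \<noteq> 0 \<Longrightarrow>
    qfrac a s \<oplus>\<^bsub>quintic_ring\<^esub> qfrac b t = qfrac (a * t + b * s) (s * t)"
  unfolding quintic_ring_def qfrac_def
  by (subst mult_subset.localization_add[OF mult_subset_origin])
    (auto simp: residue_in_complement residue_in_carrier residue_in_origin_iff residue_mult residue_add)

lemma qfrac_one: "\<one>\<^bsub>quintic_ring\<^esub> = qfrac 1 1"
  by (simp add: quintic_ring_def qfrac_def localization_def residue_one)

lemma qfrac_zero: "\<zero>\<^bsub>quintic_ring\<^esub> = qfrac 0 1"
  by (simp add: quintic_ring_def qfrac_def localization_def residue_one residue_zero)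

lemma qfrac_power: "lookup s 0 \<noteq> 0 \<Longrightarrow> qfrac a s [^]\<^bsub>quintic_ring\<^esub> n = qfrac (a ^ n) (s ^ (n :: nat))"
proof (induction n)
  case (Suc n)
  then show ?case
    by (simp add: monoid.nat_pow_Suc[OF cring.axioms(2)[OF cring_quintic_ring, THEN comm_monoid.axioms(1)]]
        qfrac_mult lookup_power_zero mult.commute)
qed (simp add: qfrac_one)

text \<open>The extra denominator \<open>w\<close> in equality of fractions cancels: F is prime and
  cannot divide a polynomial with nonzero constant term.\<close>

lemma qfrac_eq_iff:
  fixes a b s t :: "'k::field poly5"
  assumes "CHAR('k) = 2" "lookup s 0 \<noteq> 0" "lookup t 0 \<noteq> 0"
  shows "qfrac a s = qfrac b t \<longleftrightarrow> quintic dvd a * t - b * s"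
proof -
  interpret mult_subset "quintic_quot :: 'k poly5 set ring" "carrier quintic_quot - quot_origin"
    by (rule mult_subset_origin)
  have "qfrac a s = qfrac b t \<longleftrightarrow> (\<exists>W \<in> carrier quintic_quot - quot_origin.
      W \<otimes>\<^bsub>quintic_quot\<^esub> (residue a \<otimes>\<^bsub>quintic_quot\<^esub> residue t) =
      W \<otimes>\<^bsub>quintic_quot\<^esub> (residue b \<otimes>\<^bsub>quintic_quot\<^esub> residue s))"
    unfolding qfrac_def using assms(2,3)
    by (intro fraction_eq_iff) (auto simp: residue_in_complement residue_in_carrier residue_in_origin_iff)
  also have "\<dots> \<longleftrightarrow> (\<exists>w. lookup w 0 \<noteq> 0 \<and> quintic dvd w * (a * t - b * s))"
  proof -
    have "(\<exists>W \<in> carrier quintic_quot - quot_origin. P W) \<longleftrightarrow> (\<exists>w. lookup w 0 \<noteq> 0 \<and> P (residue w))"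
      for P :: "'k poly5 set \<Rightarrow> bool"
      by (auto simp: carrier_quintic_quot residue_in_origin_iff)
    then show ?thesis by (simp add: residue_mult residue_eq_iff right_diff_distrib)
  qed
  also have "\<dots> \<longleftrightarrow> quintic dvd a * t - b * s"
  proof
    assume "\<exists>w. lookup w 0 \<noteq> 0 \<and> quintic dvd w * (a * t - b * s)"
    then show "quintic dvd a * t - b * s"
      using quintic_prime[OF assms(1)] quintic_dvd_lookup_zero by blast
  qed (auto intro: exI[of _ 1])
  finally show ?thesis .
qed

lemma domain_quintic_ring:
  assumes char2: "CHAR('k::field) = 2"
  shows "domain (quintic_ring :: 'k quintic_elem ring)"
proof (rule domain.intro[OF cring_quintic_ring], unfold_locales)
  show "\<one>\<^bsub>quintic_ring\<^esub> \<noteq> (\<zero>\<^bsub>quintic_ring\<^esub> :: 'k quintic_elem)"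
    using quintic_dvd_lookup_zero[of "1 :: 'k poly5"]
    by (auto simp: qfrac_one qfrac_zero qfrac_eq_iff[OF char2])
next
  fix X Y :: "'k quintic_elem"
  assume XY: "X \<otimes>\<^bsub>quintic_ring\<^esub> Y = \<zero>\<^bsub>quintic_ring\<^esub>"
    and "X \<in> carrier quintic_ring" "Y \<in> carrier quintic_ring"
  then obtain a s b t where "X = qfrac a s" "Y = qfrac b t" "lookup s 0 \<noteq> 0" "lookup t 0 \<noteq> 0"
    unfolding carrier_quintic_ring by blast
  with XY show "X = \<zero>\<^bsub>quintic_ring\<^esub> \<or> Y = \<zero>\<^bsub>quintic_ring\<^esub>"
    using quintic_prime[OF char2, of a b]
    by (simp add: qfrac_mult qfrac_zero qfrac_eq_iff[OF char2] lookup_mult_zero)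
qed

section \<open>Frobenius powers of ideals of fractions\<close>

lemma (in cring) frobenius_power_ideal:
  assumes "ideal I R"
  shows "ideal (frobenius_power R I q) R"
proof -
  interpret I: ideal I R by fact
  show ?thesis
    unfolding frobenius_power_def by (rule genideal_ideal) (auto intro: I.Icarr)
qed

lemma (in cring) power_in_frobenius_power:
  assumes "ideal I R" "a \<in> I"
  shows "a [^] q \<in> frobenius_power R I q"
proof -
  interpret I: ideal I R by fact
  have "{a [^] q | a. a \<in> I} \<subseteq> carrier R" by (auto intro: I.Icarr)
  then show ?thesis
    unfolding frobenius_power_def using genideal_self assms(2) by blast
qed

lemma (in cring) frobenius_power_one_subset:
  assumes "ideal I R"
  shows "frobenius_power R I 1 \<subseteq> I"
proof -
  interpret I: ideal I R by fact
  show ?thesis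
    unfolding frobenius_power_def by (rule genideal_minimal[OF assms]) (auto simp: I.Icarr)
qed

lemma (in cring) test_ideal_is_ideal: "ideal (test_ideal p R) R"
proof (rule idealI_cring)
  fix x y
  assume xy: "x \<in> test_ideal p R" "y \<in> test_ideal p R"
  then have xy_carr: "x \<in> carrier R" "y \<in> carrier R" by (auto simp: test_ideal_def)
  have "(x \<oplus> y) \<otimes> u [^] (p ^ e) \<in> frobenius_power R I (p ^ e)"
    if "ideal I R" "u \<in> tight_closure p R I" for I u e
  proof -
    interpret F: ideal "frobenius_power R I (p ^ e)" R
      using that(1) by (rule frobenius_power_ideal)
    have "u \<in> carrier R" using that by (simp add: tight_closure_def)
    then have "(x \<oplus> y) \<otimes> u [^] (p ^ e) = x \<otimes> u [^] (p ^ e) \<oplus> y \<otimes> u [^] (p ^ e)"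
      using xy_carr by (simp add: l_distr)
    also have "\<dots> \<in> frobenius_power R I (p ^ e)"
      using xy that by (intro F.a_closed) (auto simp: test_ideal_def)
    finally show ?thesis .
  qed
  with xy_carr show "x \<oplus> y \<in> test_ideal p R" by (simp add: test_ideal_def)
next
  fix r x
  assume rx: "r \<in> carrier R" "x \<in> test_ideal p R"
  then have x_carr: "x \<in> carrier R" by (auto simp: test_ideal_def)
  have "(r \<otimes> x) \<otimes> u [^] (p ^ e) \<in> frobenius_power R I (p ^ e)"
    if "ideal I R" "u \<in> tight_closure p R I" for I u e
  proof -
    interpret F: ideal "frobenius_power R I (p ^ e)" R
      using that(1) by (rule frobenius_power_ideal)
    have "u \<in> carrier R" using that by (simp add: tight_closure_def)
    then have "(r \<otimes> x) \<otimes> u [^] (p ^ e) = r \<otimes> (x \<otimes> u [^] (p ^ e))"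
      using rx x_carr by (simp add: m_assoc)
    also have "\<dots> \<in> frobenius_power R I (p ^ e)"
      by (rule F.I_l_closed) (use rx that in \<open>auto simp: test_ideal_def\<close>)
    finally show ?thesis .
  qed
  with rx x_carr show "r \<otimes> x \<in> test_ideal p R" by (simp add: test_ideal_def)
next
  have "\<zero> \<otimes> u [^] (p ^ e) \<in> frobenius_power R I (p ^ e)"
    if "ideal I R" "u \<in> tight_closure p R I" for I u e
  proof -
    interpret F: ideal "frobenius_power R I (p ^ e)" R
      using that(1) by (rule frobenius_power_ideal)
    have "u \<in> carrier R" using that by (simp add: tight_closure_def)
    then show ?thesis by (simp add: F.zero_closed)
  qed
  then show "\<zero> \<in> test_ideal p R" by (simp add: test_ideal_def)
qed (auto simp: test_ideal_def)

section \<open>Polynomial numerators of ideal members\<close>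

abbreviation num_in :: "'k::field quintic_elem set \<Rightarrow> 'k poly5 \<Rightarrow> bool" where
  "num_in I a \<equiv> qfrac a 1 \<in> I"

locale quintic_ideal_char2 = ideal I quintic_ring for I :: "'k::field quintic_elem set" +
  assumes char2: "CHAR('k) = 2"
begin

lemma num_in_mult: "num_in I a \<Longrightarrow> num_in I (h * a)"
  using I_l_closed[of "qfrac a 1" "qfrac h 1"] by (simp add: qfrac_mult)

lemma num_in_add: "num_in I a \<Longrightarrow> num_in I b \<Longrightarrow> num_in I (a + b)"
  using additive_subgroup.a_closed[OF additive_subgroup_axioms, of "qfrac a 1" "qfrac b 1"]
  by (simp add: qfrac_add)

lemma num_in_dvd: "quintic dvd a \<Longrightarrow> num_in I a"
proof -
  assume "quintic dvd a"
  then have "qfrac a 1 = qfrac 0 1" by (simp add: qfrac_eq_iff[OF char2])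
  then show ?thesis
    using additive_subgroup.zero_closed[OF additive_subgroup_axioms] by (simp add: qfrac_zero)
qed

lemma num_in_cong:
  assumes "quintic dvd a - b" "num_in I b"
  shows "num_in I a"
  using num_in_add[OF num_in_dvd[OF assms(1)] assms(2)] by simp

lemma num_in_sum: "(\<And>i. i \<in> A \<Longrightarrow> num_in I (f i)) \<Longrightarrow> num_in I (sum f A)"
  by (induction A rule: infinite_finite_induct) (auto intro: num_in_add num_in_dvd)

lemma qfrac_in_iff:
  assumes "lookup s 0 \<noteq> 0"
  shows "qfrac a s \<in> I \<longleftrightarrow> num_in I a"
proof
  assume "qfrac a s \<in> I"
  then have "qfrac s 1 \<otimes>\<^bsub>quintic_ring\<^esub> qfrac a s \<in> I" by (simp add: I_l_closed)
  also have "qfrac s 1 \<otimes>\<^bsub>quintic_ring\<^esub> qfrac a s = qfrac a 1"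
    using assms by (simp add: qfrac_mult qfrac_eq_iff[OF char2])
  finally show "num_in I a" .
next
  assume "num_in I a"
  then have "qfrac 1 s \<otimes>\<^bsub>quintic_ring\<^esub> qfrac a 1 \<in> I" using assms by (simp add: I_l_closed)
  then show "qfrac a s \<in> I" using assms by (simp add: qfrac_mult)
qed

text \<open>Polynomials with nonzero constant term are units of the local ring.\<close>

lemma num_in_unit_mult:
  assumes "lookup s 0 \<noteq> 0" "num_in I (s * a)"
  shows "num_in I a"
proof -
  have "qfrac (s * a) s = qfrac a 1"
    using assms(1) by (simp add: qfrac_eq_iff[OF char2])
  then show ?thesis using assms qfrac_in_iff[of s "s * a"] by simp
qed

lemma frobenius_power_char2: "quintic_ideal_char2 (frobenius_power quintic_ring I q)"
  by (rule quintic_ideal_char2.intro)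
    (auto simp: quintic_ideal_char2_axioms_def char2
      intro: cring.frobenius_power_ideal[OF cring_quintic_ring] ideal_axioms)

end

text \<open>A Fedder-type descent. The factor F^(2^e - 1) turns multiples of F into multiples of
  F^(2^e), which \<open>froot\<close> maps into (F), so the trace acts modulo F. It sends multiples
  of h^(2^e) to multiples of h and so lowers the Frobenius power by the factor 2^e.\<close>

lemma froot_num_in_frobenius_power:
  fixes I :: "'k::field quintic_elem set"
  assumes "quintic_ideal_char2 I" "inverse_frobenius l e"
    and T: "num_in (frobenius_power quintic_ring I (2 ^ e * q)) T"
  shows "num_in (frobenius_power quintic_ring I q) (inverse_frobenius.froot l e r (quintic ^ (2 ^ e - 1) * T))"
proof -
  interpret L: cring "quintic_ring :: 'k quintic_elem ring" by (rule cring_quintic_ring)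
  interpret I: quintic_ideal_char2 I by fact
  interpret inverse_frobenius l e by fact
  interpret J: quintic_ideal_char2 "frobenius_power quintic_ring I q"
    by (rule I.frobenius_power_char2)
  \<comment> \<open>Quantifying over \<open>g\<close> makes \<open>N\<close> stable under
    multiplication. The fractions with numerators in \<open>N\<close> then form an ideal
    \<open>K\<close>, and only the generators of the Frobenius power need checking.\<close>
  define N where "N t \<longleftrightarrow> (\<forall>g. num_in (frobenius_power quintic_ring I q) (froot r (g * quintic ^ (2 ^ e - 1) * t)))" for t
  define K where "K = {qfrac t s | t s. lookup s 0 \<noteq> 0 \<and> N t}"
  have K_I: "qfrac t s \<in> K" if "lookup s 0 \<noteq> 0" "N t" for t s
    unfolding K_def using that by (intro CollectI exI conjI) auto
  have N_mult: "N (h * t)" if "N t" for h t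
    unfolding N_def
  proof
    fix g
    have "g * quintic ^ (2 ^ e - 1) * (h * t) = (g * h) * quintic ^ (2 ^ e - 1) * t"
      by (simp add: mult_ac)
    then show "num_in (frobenius_power quintic_ring I q) (froot r (g * quintic ^ (2 ^ e - 1) * (h * t)))"
      using that by (simp only: N_def)
  qed
  have N_add: "N (t + t')" if "N t" "N t'" for t t'
    using that by (simp add: N_def distrib_left froot_add J.num_in_add)
  have "ideal K quintic_ring"
  proof (rule L.idealI_cring)
    show "K \<subseteq> carrier quintic_ring" by (auto simp: K_def)
    have "N 0" by (simp add: N_def J.num_in_dvd)
    then show "\<zero>\<^bsub>quintic_ring\<^esub> \<in> K"
      unfolding qfrac_zero by (intro K_I) simp_all
  next
    fix X Y assume "X \<in> K" "Y \<in> K"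
    then obtain t s t' s' where *: "X = qfrac t s" "Y = qfrac t' s'" "lookup s 0 \<noteq> 0" "lookup s' 0 \<noteq> 0"
      "N t" "N t'" unfolding K_def by blast
    then have "X \<oplus>\<^bsub>quintic_ring\<^esub> Y = qfrac (s' * t + s * t') (s * s')" "lookup (s * s') 0 \<noteq> 0"
      by (simp_all add: qfrac_add lookup_mult_zero mult.commute)
    moreover have "N (s' * t + s * t')" using * by (intro N_add N_mult)
    ultimately show "X \<oplus>\<^bsub>quintic_ring\<^esub> Y \<in> K" by (simp only: K_I not_False_eq_True)
  next
    fix X Y :: "'k quintic_elem" assume "X \<in> carrier quintic_ring" "Y \<in> K"
    then obtain t s t' s' where *: "X = qfrac t s" "Y = qfrac t' s'" "lookup s 0 \<noteq> 0" "lookup s' 0 \<noteq> 0"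
      "N t'" unfolding K_def carrier_quintic_ring by blast
    then have "X \<otimes>\<^bsub>quintic_ring\<^esub> Y = qfrac (t * t') (s * s')" "lookup (s * s') 0 \<noteq> 0"
      by (simp_all add: qfrac_mult lookup_mult_zero)
    moreover have "N (t * t')" using * by (intro N_mult)
    ultimately show "X \<otimes>\<^bsub>quintic_ring\<^esub> Y \<in> K" by (simp only: K_I not_False_eq_True)
  qed
  moreover have "a [^]\<^bsub>quintic_ring\<^esub> (2 ^ e * q) \<in> K" if "a \<in> I" for a
  proof -
    from I.Icarr[OF that] obtain \<alpha> s where a: "a = qfrac \<alpha> s" "lookup s 0 \<noteq> 0"
      unfolding carrier_quintic_ring by blast
    have "num_in I \<alpha>" using that I.qfrac_in_iff[OF a(2)] by (simp only: a(1))
    then have "qfrac \<alpha> 1 [^]\<^bsub>quintic_ring\<^esub> q \<in> frobenius_power quintic_ring I q"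
      by (rule L.power_in_frobenius_power[OF I.ideal_axioms])
    then have \<alpha>: "num_in (frobenius_power quintic_ring I q) (\<alpha> ^ q)" by (simp add: qfrac_power)
    have "N (\<alpha> ^ (2 ^ e * q))"
      unfolding N_def
    proof
      fix g
      have "g * quintic ^ (2 ^ e - 1) * \<alpha> ^ (2 ^ e * q) = (\<alpha> ^ q) ^ (2 ^ e) * (g * quintic ^ (2 ^ e - 1))"
        by (simp add: mult.commute flip: power_mult)
      then have "froot r (g * quintic ^ (2 ^ e - 1) * \<alpha> ^ (2 ^ e * q)) =
        froot r (g * quintic ^ (2 ^ e - 1)) * \<alpha> ^ q"
        by (simp only: froot_scale) (rule mult.commute)
      then show "num_in (frobenius_power quintic_ring I q) (froot r (g * quintic ^ (2 ^ e - 1) * \<alpha> ^ (2 ^ e * q)))"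
        using J.num_in_mult[OF \<alpha>] by simp
    qed
    moreover have "lookup (s ^ (2 ^ e * q)) 0 \<noteq> 0" using a by (simp add: lookup_power_zero)
    moreover have "a [^]\<^bsub>quintic_ring\<^esub> (2 ^ e * q) = qfrac (\<alpha> ^ (2 ^ e * q)) (s ^ (2 ^ e * q))"
      using a by (simp add: qfrac_power)
    ultimately show ?thesis by (simp only: K_I not_False_eq_True)
  qed
  then have "{a [^]\<^bsub>quintic_ring\<^esub> (2 ^ e * q) | a. a \<in> I} \<subseteq> K" by blast
  ultimately have "frobenius_power quintic_ring I (2 ^ e * q) \<subseteq> K"
    unfolding frobenius_power_def by (rule L.genideal_minimal)
  with T have "qfrac T 1 \<in> K" by blast
  then obtain t s where ts: "qfrac T 1 = qfrac t s" "lookup s 0 \<noteq> 0" "N t"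
    unfolding K_def by blast
  then have "quintic dvd T * s - t" by (simp add: qfrac_eq_iff[OF I.char2])
  then obtain h where "T * s - t = quintic * h" by (rule dvdE)
  then have h: "T * s = t + quintic * h" by (simp add: algebra_simps)
  \<comment> \<open>Multiplying by \<open>s\<^bsup>q-1\<^esup>\<close> makes the denominator a \<open>q\<close>-th power, which \<open>froot\<close> extracts.\<close>
  have pow: "x ^ (2 ^ e) = x ^ (2 ^ e - 1) * x" for x :: "'k poly5"
    by (subst power_Suc2[symmetric]) simp
  have "s ^ (2 ^ e) * (quintic ^ (2 ^ e - 1) * T) = s ^ (2 ^ e - 1) * quintic ^ (2 ^ e - 1) * (T * s)"
    by (simp only: pow mult_ac)
  \<comment> \<open>The error F h of the representation of T s becomes a multiple of F^(2^e), so its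
    trace is a multiple of F, zero in the local ring.\<close>
  also have "\<dots> = s ^ (2 ^ e - 1) * quintic ^ (2 ^ e - 1) * t + quintic ^ (2 ^ e) * (s ^ (2 ^ e - 1) * h)"
    by (simp only: h pow distrib_left distrib_right mult_ac)
  finally have "s * froot r (quintic ^ (2 ^ e - 1) * T) =
    froot r (s ^ (2 ^ e - 1) * quintic ^ (2 ^ e - 1) * t) + quintic * froot r (s ^ (2 ^ e - 1) * h)"
    by (simp only: froot_scale[symmetric] froot_add)
  moreover have "num_in (frobenius_power quintic_ring I q) (froot r (s ^ (2 ^ e - 1) * quintic ^ (2 ^ e - 1) * t))"
    using ts(3) by (simp only: N_def)
  moreover have "num_in (frobenius_power quintic_ring I q) (quintic * froot r (s ^ (2 ^ e - 1) * h))"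
    by (rule J.num_in_dvd) simp
  ultimately have "num_in (frobenius_power quintic_ring I q) (s * froot r (quintic ^ (2 ^ e - 1) * T))"
    by (simp only: J.num_in_add)
  then show ?thesis by (rule J.num_in_unit_mult[OF ts(2)])
qed

section \<open>Elements of the test ideal\<close>

text \<open>The test condition for a single pair \<open>I\<close>, \<open>u\<close>, phrased on
  numerators so that traces apply.\<close>

definition multiplier :: "'k::field quintic_elem set \<Rightarrow> 'k poly5 \<Rightarrow> 'k poly5 \<Rightarrow> bool" where
  "multiplier I u d \<longleftrightarrow> (\<forall>e. num_in (frobenius_power quintic_ring I (2 ^ e)) (d * u ^ (2 ^ e)))"

text \<open>The power of \<open>u\<close> with exponent 2^(e + e') is a 2^e-th power and passes
  through the trace. A containment known only from exponent \<open>e\<close> on thus yields one for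
  all exponents.\<close>

lemma multiplier_froot:
  assumes I: "quintic_ideal_char2 I" and l: "inverse_frobenius l e"
    and d: "\<And>e'. num_in (frobenius_power quintic_ring I (2 ^ (e + e'))) (d * u ^ (2 ^ (e + e')))"
  shows "multiplier I u (inverse_frobenius.froot l e r (quintic ^ (2 ^ e - 1) * d))"
  unfolding multiplier_def
proof
  fix e'
  interpret inverse_frobenius l e by fact
  have "num_in (frobenius_power quintic_ring I (2 ^ e'))
    (froot r (quintic ^ (2 ^ e - 1) * (d * u ^ (2 ^ (e + e')))))"
    by (rule froot_num_in_frobenius_power[OF I l]) (use d[of e'] in \<open>simp add: power_add\<close>)
  also have "quintic ^ (2 ^ e - 1) * (d * u ^ (2 ^ (e + e'))) =
    (u ^ (2 ^ e')) ^ (2 ^ e) * (quintic ^ (2 ^ e - 1) * d)"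
    by (simp add: power_add mult_ac flip: power_mult)
  also have "froot r \<dots> = froot r (quintic ^ (2 ^ e - 1) * d) * u ^ (2 ^ e')"
    by (subst froot_scale) (rule mult.commute)
  finally show "num_in (frobenius_power quintic_ring I (2 ^ e')) (froot r (quintic ^ (2 ^ e - 1) * d) * u ^ (2 ^ e'))" .
qed

lemma multiplier_mon_step:
  fixes u :: "'k::field poly5"
  assumes I: "quintic_ideal_char2 I" and a: "multiplier I u (mon a)"
  shows "multiplier I u (mon (\<lambda>k. (a k + (if k = i then 5 else 0)) div 2))"
proof -
  interpret I: quintic_ideal_char2 I by fact
  obtain l :: "'k \<Rightarrow> 'k" where l: "inverse_frobenius l 1" "l 1 = 1"
    using inverse_frobenius_exists[OF I.char2, of 1] by auto
  have "multiplier I u (inverse_frobenius.froot l 1 (\<lambda>k. (a k + (if k = i then 5 else 0)) mod 2)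
    (quintic ^ (2 ^ 1 - 1) * mon a))"
    by (rule multiplier_froot[OF I l(1)]) (use a in \<open>simp only: multiplier_def\<close>)
  then show ?thesis
    using inverse_frobenius.froot_quintic_mon[OF l(1) refl l(2)] by simp
qed

section \<open>From tight closure to cubic multipliers\<close>

lemma zero_minimal_prime:
  assumes "CHAR('k::field) = 2"
  shows "minimal_prime (quintic_ring :: 'k quintic_elem ring) {\<zero>\<^bsub>quintic_ring\<^esub>}"
proof -
  interpret domain "quintic_ring :: 'k quintic_elem ring" by (rule domain_quintic_ring[OF assms])
  have "Q = {\<zero>\<^bsub>quintic_ring\<^esub>}" if "primeideal Q quintic_ring" "Q \<subseteq> {\<zero>\<^bsub>quintic_ring\<^esub>}"
    for Q :: "'k quintic_elem set"
    using additive_subgroup.zero_closed[OF ideal.axioms(1)[OF primeideal.axioms(1)[OF that(1)]]] that(2)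
    by blast
  then show ?thesis using zeroprimeideal by (auto simp: minimal_prime_def)
qed

text \<open>The multiplier from tight closure is nonzero because the zero ideal is a minimal prime.
  A multiple of it free of x_0 has a trace equal to x_0^4, whatever \<open>I\<close> and
  \<open>u\<close> are.\<close>

lemma multiplier_start:
  fixes u s :: "'k::field poly5"
  assumes I: "quintic_ideal_char2 I" and s: "lookup s 0 \<noteq> 0"
    and u: "qfrac u s \<in> tight_closure 2 quintic_ring I"
  shows "multiplier I u (mon (\<lambda>i. if i = 0 then 4 else 0))"
proof -
  interpret I: quintic_ideal_char2 I by fact
  obtain C e0 where C: "C \<in> carrier quintic_ring" "\<And>P. minimal_prime quintic_ring P \<Longrightarrow> C \<notin> P"
    "\<And>e. e \<ge> e0 \<Longrightarrow> C \<otimes>\<^bsub>quintic_ring\<^esub> qfrac u s [^]\<^bsub>quintic_ring\<^esub> (2 ^ e :: nat) \<in>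
      frobenius_power quintic_ring I (2 ^ e)"
    using u by (auto simp: tight_closure_def)
  obtain c t where c: "C = qfrac c t" "lookup t 0 \<noteq> 0"
    using C(1) unfolding carrier_quintic_ring by blast
  have "C \<noteq> \<zero>\<^bsub>quintic_ring\<^esub>" using C(2)[OF zero_minimal_prime[OF I.char2]] by simp
  then have "\<not> quintic dvd c" using c by (simp add: qfrac_zero qfrac_eq_iff[OF I.char2])
  then obtain a h where a: "a \<noteq> 0" "free0 a" "quintic dvd c * h - a"
    using free0_multiple_mod_quintic[OF I.char2] by metis
  obtain e l r where e: "e \<ge> e0" "inverse_frobenius l e"
    "inverse_frobenius.froot l e r (quintic ^ (2 ^ e - 1) * a) = mon (\<lambda>i. if i = 0 then 4 else 0)"
    using froot_quintic_power_exists[OF I.char2 a(1,2), of e0] by blast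
  have "num_in (frobenius_power quintic_ring I (2 ^ (e + e'))) (a * u ^ (2 ^ (e + e')))" for e'
  proof -
    define q :: nat where "q = 2 ^ (e + e')"
    interpret J: quintic_ideal_char2 "frobenius_power quintic_ring I q"
      by (rule I.frobenius_power_char2)
    have "qfrac (c * u ^ q) (t * s ^ q) \<in> frobenius_power quintic_ring I q"
      using C(3)[of "e + e'"] e(1) c s by (simp add: q_def qfrac_power qfrac_mult lookup_power_zero)
    then have "num_in (frobenius_power quintic_ring I q) (c * u ^ q)"
      by (rule J.qfrac_in_iff[THEN iffD1, rotated])
        (use c s in \<open>simp add: lookup_mult_zero lookup_power_zero\<close>)
    then have "num_in (frobenius_power quintic_ring I q) (h * (c * u ^ q))" by (rule J.num_in_mult)
    moreover have "a * u ^ q - h * (c * u ^ q) = - ((c * h - a) * u ^ q)" by (simp add: algebra_simps)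
    then have "quintic dvd a * u ^ q - h * (c * u ^ q)" using a(3) by simp
    ultimately show ?thesis unfolding q_def[symmetric] by (rule J.num_in_cong[rotated])
  qed
  from multiplier_froot[OF I e(2) this] show ?thesis using e(3) by metis
qed

lemma multiplier_cubic:
  fixes u s :: "'k::field poly5"
  assumes I: "quintic_ideal_char2 I" and s: "lookup s 0 \<noteq> 0"
    and u: "qfrac u s \<in> tight_closure 2 quintic_ring I"
  shows "multiplier I u (mon (\<lambda>k. (if k = i then 2 else 0) + (if k = j then 1 else 0)))"
proof -
  note start = multiplier_start[OF I s u]
  note step = multiplier_mon_step[OF I]
  have cong: "multiplier I u (mon b)" if "multiplier I u (mon a)" "\<And>k. a k = b k" for a b
  proof -
    have "a = b" using that(2) by (rule ext)
    with that(1) show ?thesis by simp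
  qed
  \<comment> \<open>The path is x_0^4, x_0^2 x_n^2, x_0 x_n x_m^2, x_m^3, adding 5 at n, m, m before
    each halving.\<close>
  have cube_other: "multiplier I u (mon (\<lambda>k. if k = m then 3 else 0))" if "m \<noteq> 0" for m
  proof -
    obtain n :: 5 where n: "n \<noteq> 0" "n \<noteq> m" using exists_other_5 by blast
    have "multiplier I u (mon (\<lambda>k. if k = 0 \<or> k = n then 2 else 0))"
      by (rule cong[OF step[OF start, of n]]) (use n in auto)
    then have "multiplier I u (mon (\<lambda>k. if k = 0 \<or> k = n then 1 else if k = m then 2 else 0))"
      by (rule cong[OF step[of _ _ m]]) (use n that in auto)
    then show ?thesis
      by (rule cong[OF step[of _ _ m]]) (use n that in auto)
  qed
  \<comment> \<open>Adding 5 at m to x_n^3 and halving gives x_m^2 x_n.\<close>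
  have square: "multiplier I u (mon (\<lambda>k. if k = m then 2 else if k = n then 1 else 0))"
    if "multiplier I u (mon (\<lambda>k. if k = n then 3 else 0))" "m \<noteq> n" for m n
    by (rule cong[OF step[OF that(1), of m]]) (use that(2) in auto)
  have cube: "multiplier I u (mon (\<lambda>k. if k = m then 3 else 0))" for m
  proof (cases "m = 0")
    case True
    \<comment> \<open>The cube of x_0 is reached through x_0^2 x_1: adding 5 at 0 and halving
      removes x_1 and raises the exponent of x_0 to 3.\<close>
    have "multiplier I u (mon (\<lambda>k. if k = 0 then 2 else if k = 1 then 1 else 0))"
      by (rule square[OF cube_other]) auto
    then show ?thesis
      unfolding True by (rule cong[OF step[of _ _ 0]]) auto
  qed (rule cube_other)
  show ?thesis
  proof (cases "i = j")
    case True
    then show ?thesis by (intro cong[OF cube[of i]]) auto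
  next
    case False
    then show ?thesis by (intro cong[OF square[OF cube[of j], of i]]) auto
  qed
qed

lemma cubic_in_test_ideal:
  assumes char2: "CHAR('k::field) = 2"
  shows "qfrac (poly5_var i ^ 2 * poly5_var j) 1 \<in> test_ideal 2 (quintic_ring :: 'k quintic_elem ring)"
  unfolding test_ideal_def
proof (intro CollectI conjI allI impI ballI)
  fix I :: "'k quintic_elem set" and U and e :: nat
  assume "ideal I quintic_ring" and U: "U \<in> tight_closure 2 quintic_ring I"
  then have I: "quintic_ideal_char2 I"
    using char2 by (auto simp: quintic_ideal_char2_def quintic_ideal_char2_axioms_def)
  interpret J: quintic_ideal_char2 "frobenius_power quintic_ring I (2 ^ e)"
    by (rule quintic_ideal_char2.frobenius_power_char2[OF I])
  have "U \<in> carrier quintic_ring" using U by (simp add: tight_closure_def)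
  then obtain u s where us: "U = qfrac u s" "lookup s 0 \<noteq> 0"
    unfolding carrier_quintic_ring by blast
  have "poly5_var i ^ 2 * poly5_var j =
    (mon (\<lambda>k. (if k = i then 2 else 0) + (if k = j then 1 else 0)) :: 'k poly5)"
    by (simp only: poly5_var_power poly5_var_eq[of j] mon_mult)
  then have "num_in (frobenius_power quintic_ring I (2 ^ e)) (poly5_var i ^ 2 * poly5_var j * u ^ (2 ^ e))"
    using multiplier_cubic[OF I us(2)] U us(1) by (simp only: multiplier_def)
  then have "qfrac (poly5_var i ^ 2 * poly5_var j * u ^ (2 ^ e)) (s ^ (2 ^ e)) \<in>
      frobenius_power quintic_ring I (2 ^ e)"
    by (rule J.qfrac_in_iff[THEN iffD2, rotated]) (use us in \<open>simp add: lookup_power_zero\<close>)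
  then show "qfrac (poly5_var i ^ 2 * poly5_var j) 1 \<otimes>\<^bsub>quintic_ring\<^esub> U [^]\<^bsub>quintic_ring\<^esub> (2 ^ e :: nat) \<in>
      frobenius_power quintic_ring I (2 ^ e)"
    using us by (simp add: qfrac_power qfrac_mult lookup_power_zero)
qed simp

section \<open>Monomial ideals and the upper bound\<close>

lemma dvd_power_diff: "(d :: 'a::comm_ring_1) dvd a - b \<Longrightarrow> d dvd a ^ n - b ^ n"
  by (subst power_diff_sumr2) (rule dvd_mult2)

text \<open>For q = 2^n the first bound lets x_i^5 be split off Z^q and replaced modulo F by the sum
  of the other x_j^5; the second makes each resulting term divisible by x_j^(4q). So c = 1 is a
  witness.\<close>

lemma mon_in_tight_closure:
  fixes i :: 5
  assumes char2: "CHAR('k::field) = 2"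
    and n: "2 ^ n * \<alpha> \<ge> 5" "2 ^ n * \<beta> + 5 \<ge> 2 ^ n * (4 :: nat)"
    and I: "ideal I quintic_ring" "\<And>j. j \<noteq> i \<Longrightarrow> num_in I (poly5_var j ^ 4 :: 'k poly5)"
  shows "qfrac (mon (\<lambda>k. if k = i then \<alpha> else \<beta>)) 1 \<in> tight_closure 2 quintic_ring I"
proof -
  let ?Z = "mon (\<lambda>k. if k = i then \<alpha> else \<beta>) :: 'k poly5"
  define q :: nat where "q = 2 ^ n"
  \<comment> \<open>\<open>h j\<close> is the cofactor of x_j^(4q) in x_j^5 w, where
    \<open>w\<close> is Z^q divided by x_i^5. The hypotheses on \<open>n\<close> keep all
    subtractions exact.\<close>
  define h where "h j = (mon (\<lambda>k. if k = i then q * \<alpha> - 5 else if k = j then q * \<beta> + 5 - q * 4 else q * \<beta>) :: 'k poly5)" for j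
  define w where "w = (mon (\<lambda>k. if k = i then q * \<alpha> - 5 else q * \<beta>) :: 'k poly5)"
  have char2': "CHAR('k poly5) = 2" using char2 by simp
  interpret L: cring "quintic_ring :: 'k quintic_elem ring" by (rule cring_quintic_ring)
  interpret I: quintic_ideal_char2 I
    using I(1) char2 by (auto simp: quintic_ideal_char2_def quintic_ideal_char2_axioms_def)
  have Z: "?Z ^ q = poly5_var i ^ 5 * w"
    unfolding w_def poly5_var_power mon_power mon_mult
    using n by (intro arg_cong2[where f = single] arg_cong[where f = expo] ext) (auto simp: q_def)
  have h: "poly5_var j ^ 5 * w = h j * (poly5_var j ^ 4) ^ q" if "j \<noteq> i" for j
    unfolding w_def h_def poly5_var_power mon_power mon_mult
    using n that by (intro arg_cong2[where f = single] arg_cong[where f = expo] ext) (auto simp: q_def)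
  have "?Z ^ q - (\<Sum>j\<in>-{i}. h j * (poly5_var j ^ 4) ^ q) = (poly5_var i ^ 5 + (\<Sum>j\<in>-{i}. poly5_var j ^ 5)) * w"
    by (simp add: minus_eq_plus_char2[OF char2'] Z h distrib_right sum_distrib_right)
  also have "poly5_var i ^ 5 + (\<Sum>j\<in>-{i}. poly5_var j ^ 5) = (quintic :: 'k poly5)"
    unfolding quintic_def by (subst (2) sum.remove[of _ i]) (auto intro!: sum.cong)
  finally have Zq: "quintic dvd ?Z ^ q - (\<Sum>j\<in>-{i}. h j * (poly5_var j ^ 4) ^ q)" by simp
  have "num_in (frobenius_power quintic_ring I (2 ^ e)) (?Z ^ (2 ^ e))" if "e \<ge> n" for e
  proof -
    interpret J: quintic_ideal_char2 "frobenius_power quintic_ring I (2 ^ e)"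
      by (rule I.frobenius_power_char2)
    from that obtain m where e: "e = n + m" by (rule less_eqE)
    \<comment> \<open>A further Frobenius power carries the relation from exponent \<open>n\<close>
      to every later one.\<close>
    have "quintic dvd (?Z ^ q) ^ (2 ^ m) - (\<Sum>j\<in>-{i}. h j * (poly5_var j ^ 4) ^ q) ^ (2 ^ m)"
      by (rule dvd_power_diff[OF Zq])
    also have "(?Z ^ q) ^ (2 ^ m) = ?Z ^ (2 ^ e)"
      by (simp only: e q_def power_add power_mult)
    also have "(\<Sum>j\<in>-{i}. h j * (poly5_var j ^ 4) ^ q) ^ (2 ^ m) =
      (\<Sum>j\<in>-{i}. h j ^ (2 ^ m) * (poly5_var j ^ 4) ^ (2 ^ e))"
      unfolding power_two_power_sum[OF char2'] power_mult_distrib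
      by (simp only: e q_def power_add power_mult)
    finally have "quintic dvd ?Z ^ (2 ^ e) - (\<Sum>j\<in>-{i}. h j ^ (2 ^ m) * (poly5_var j ^ 4) ^ (2 ^ e))" .
    moreover have "num_in (frobenius_power quintic_ring I (2 ^ e))
      (\<Sum>j\<in>-{i}. h j ^ (2 ^ m) * (poly5_var j ^ 4) ^ (2 ^ e))"
    proof (intro J.num_in_sum J.num_in_mult)
      fix j assume "j \<in> - {i}"
      then have "qfrac (poly5_var j ^ 4) 1 [^]\<^bsub>quintic_ring\<^esub> (2 ^ e :: nat) \<in> frobenius_power quintic_ring I (2 ^ e)"
        by (intro L.power_in_frobenius_power I) simp
      then show "num_in (frobenius_power quintic_ring I (2 ^ e)) ((poly5_var j ^ 4) ^ (2 ^ e))"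
        by (simp only: qfrac_power lookup_one_zero zero_neq_one[symmetric] not_False_eq_True power_one)
    qed
    ultimately show ?thesis by (rule J.num_in_cong)
  qed
  then have "\<one>\<^bsub>quintic_ring\<^esub> \<otimes>\<^bsub>quintic_ring\<^esub> qfrac ?Z 1 [^]\<^bsub>quintic_ring\<^esub> (2 ^ e :: nat) \<in>
      frobenius_power quintic_ring I (2 ^ e)" if "e \<ge> n" for e
    using that by (simp only: qfrac_one qfrac_power qfrac_mult lookup_one_zero zero_neq_one[symmetric]
        not_False_eq_True power_one mult_1_left)
  moreover have "\<one>\<^bsub>quintic_ring\<^esub> \<notin> P" if "minimal_prime quintic_ring P" for P :: "'k quintic_elem set"
    using that primeideal.I_notcarr ideal.one_imp_carrier[OF primeideal.axioms(1)]
    unfolding minimal_prime_def by blast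
  ultimately show ?thesis
    unfolding tight_closure_def
    by (intro CollectI conjI bexI[of _ "\<one>\<^bsub>quintic_ring\<^esub>"] exI[of _ n] allI impI) auto
qed

section \<open>Ideals spanned by monomials\<close>

definition mon_ideal :: "((5 \<Rightarrow> nat) \<Rightarrow> bool) \<Rightarrow> 'k::field poly5 set" where
  "mon_ideal P = {p. \<forall>v\<in>keys p. P (lookup v)}"

lemma mon_ideal_add: "p \<in> mon_ideal P \<Longrightarrow> q \<in> mon_ideal P \<Longrightarrow> p + q \<in> mon_ideal P"
  using keys_add[of p q] by (auto simp: mon_ideal_def)

text \<open>The span of the monomials selected by \<open>P\<close> becomes an ideal once
  \<open>P\<close> is stable under adding exponents.\<close>

lemma mon_ideal_mult:
  assumes "\<And>f g. P g \<Longrightarrow> P (\<lambda>i. f i + g i)" "q \<in> mon_ideal P"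
  shows "p * q \<in> mon_ideal P"
proof -
  have "P (lookup (v + w))" if "w \<in> keys q" for v w
    using assms that by (simp add: mon_ideal_def plus_poly_mapping.rep_eq)
  then show ?thesis using keys_mult[of p q] by (fastforce simp: mon_ideal_def)
qed

lemma mon_ideal_mult_bound:
  assumes "p \<in> mon_ideal (\<lambda>g. g i + \<alpha> \<ge> a \<or> (\<exists>j. j \<noteq> i \<and> g j + \<beta> \<ge> b))"
  shows "h * p \<in> mon_ideal (\<lambda>g. g i + \<alpha> \<ge> a \<or> (\<exists>j. j \<noteq> i \<and> g j + \<beta> \<ge> b))"
proof (rule mon_ideal_mult[OF _ assms])
  fix f g :: "5 \<Rightarrow> nat"
  assume "g i + \<alpha> \<ge> a \<or> (\<exists>j. j \<noteq> i \<and> g j + \<beta> \<ge> b)"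
  then show "f i + g i + \<alpha> \<ge> a \<or> (\<exists>j. j \<noteq> i \<and> f j + g j + \<beta> \<ge> b)"
  proof (elim disjE exE conjE)
    fix j assume "j \<noteq> i" "g j + \<beta> \<ge> b"
    then have "j \<noteq> i \<and> f j + g j + \<beta> \<ge> b" by simp
    then show ?thesis by blast
  qed simp
qed

lemma mon_ideal_zero: "0 \<in> mon_ideal P"
  by (simp add: mon_ideal_def)

lemma mon_ideal_mon: "mon f \<in> mon_ideal P \<longleftrightarrow> P f"
  by (simp add: mon_ideal_def) (metis (full_types) lookup_expo ext)

lemma mon_ideal_sum: "(\<And>i. i \<in> A \<Longrightarrow> f i \<in> mon_ideal P) \<Longrightarrow> sum f A \<in> mon_ideal P"
  by (induction A rule: infinite_finite_induct) (auto intro: mon_ideal_add mon_ideal_zero)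

lemma lookup_mult_mon: "lookup (p * single w 1) (v + w) = lookup (p :: 'k::field poly5) v"
proof (induction p rule: additive_induct)
  case (single u c)
  show ?case by (simp add: mult_single lookup_single when_def)
qed (auto simp: lookup_add distrib_right)

text \<open>Multiplication by a monomial translates the support, with no cancellation.\<close>

lemma mon_ideal_colon:
  "p * mon f \<in> mon_ideal P \<Longrightarrow> p \<in> mon_ideal (\<lambda>g. P (\<lambda>i. g i + f i))"
proof -
  assume p: "p * mon f \<in> mon_ideal P"
  have "P (\<lambda>i. lookup v i + f i)" if "v \<in> keys p" for v
  proof -
    have "lookup (p * mon f) (v + expo f) = lookup p v" by (rule lookup_mult_mon)
    then have "v + expo f \<in> keys (p * mon f)" using that by (simp add: in_keys_iff)
    with p show ?thesis by (auto simp: mon_ideal_def plus_poly_mapping.rep_eq)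
  qed
  then show ?thesis by (simp add: mon_ideal_def)
qed

text \<open>The test condition for Z at q = 1 puts a Z into I = (x_j^4 : j \<noteq> i). Enlarging I
  by x_i^5 gives a monomial ideal that contains F, so the colon by Z can be read off exponents. The
  factor \<open>t\<close> clears the local denominator.\<close>

lemma test_ideal_monomial_bound:
  fixes i :: 5 and a s :: "'k::field poly5"
  assumes char2: "CHAR('k) = 2"
    and n: "2 ^ n * \<alpha> \<ge> 5" "2 ^ n * \<beta> + 5 \<ge> 2 ^ n * (4 :: nat)"
    and s: "lookup s 0 \<noteq> 0" and a: "qfrac a s \<in> test_ideal 2 quintic_ring"
  shows "\<exists>t. lookup t 0 \<noteq> 0 \<and>
    t * a \<in> mon_ideal (\<lambda>g. g i + \<alpha> \<ge> 5 \<or> (\<exists>j. j \<noteq> i \<and> g j + \<beta> \<ge> 4))"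
proof -
  interpret L: cring "quintic_ring :: 'k quintic_elem ring" by (rule cring_quintic_ring)
  let ?Z = "mon (\<lambda>k. if k = i then \<alpha> else \<beta>) :: 'k poly5"
  \<comment> \<open>Exponents of the monomial ideal generated by x_i^5 and the x_j^4 with j \<noteq>
    i.\<close>
  define P :: "(5 \<Rightarrow> nat) \<Rightarrow> bool" where "P g \<longleftrightarrow> g i \<ge> 5 \<or> (\<exists>j. j \<noteq> i \<and> g j \<ge> 4)" for g
  define G where "G = {qfrac (poly5_var j ^ 4 :: 'k poly5) 1 | j. j \<noteq> i}"
  define I where "I = Idl\<^bsub>quintic_ring\<^esub> G"
  define K where "K = {qfrac b t | b t :: 'k poly5. lookup t 0 \<noteq> 0 \<and> b \<in> mon_ideal P}"
  have G: "G \<subseteq> carrier quintic_ring" by (auto simp: G_def)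
  have I: "ideal I quintic_ring" unfolding I_def by (rule L.genideal_ideal[OF G])
  have "num_in I (poly5_var j ^ 4)" if "j \<noteq> i" for j
    unfolding I_def using L.genideal_self[OF G] that by (auto simp: G_def)
  then have Z: "qfrac ?Z 1 \<in> tight_closure 2 quintic_ring I"
    by (rule mon_in_tight_closure[OF char2 n I])
  interpret I: quintic_ideal_char2 I
    using I char2 by (auto simp: quintic_ideal_char2_def quintic_ideal_char2_axioms_def)
  have "qfrac a s \<otimes>\<^bsub>quintic_ring\<^esub> qfrac ?Z 1 [^]\<^bsub>quintic_ring\<^esub> (2 ^ 0 :: nat) \<in> frobenius_power quintic_ring I (2 ^ 0)"
  proof -
    have "\<forall>I. ideal I quintic_ring \<longrightarrow> (\<forall>u \<in> tight_closure 2 quintic_ring I. \<forall>e.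
        qfrac a s \<otimes>\<^bsub>quintic_ring\<^esub> u [^]\<^bsub>quintic_ring\<^esub> (2 ^ e :: nat) \<in> frobenius_power quintic_ring I (2 ^ e))"
      using a by (simp add: test_ideal_def)
    from this[rule_format, OF I Z, of 0] show ?thesis .
  qed
  then have "qfrac a s \<otimes>\<^bsub>quintic_ring\<^esub> qfrac ?Z 1 [^]\<^bsub>quintic_ring\<^esub> (1 :: nat) \<in> I"
    unfolding power_0 by (rule subsetD[OF L.frobenius_power_one_subset[OF I]])
  then have aZ: "qfrac (a * ?Z) s \<in> I"
    using s by (simp add: qfrac_power qfrac_mult)
  have K_I: "qfrac b t \<in> K" if "lookup t 0 \<noteq> 0" "b \<in> mon_ideal P" for b t
    unfolding K_def using that by (intro CollectI exI conjI) auto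
  have P_mono: "P (\<lambda>i. f i + g i)" if "P g" for f g :: "5 \<Rightarrow> nat"
    unfolding P_def using that[unfolded P_def]
  proof (elim disjE exE conjE)
    fix j assume "j \<noteq> i" "g j \<ge> 4"
    then have "j \<noteq> i \<and> f j + g j \<ge> 4" by simp
    then show "f i + g i \<ge> 5 \<or> (\<exists>j. j \<noteq> i \<and> f j + g j \<ge> 4)" by blast
  qed simp
  have "ideal K quintic_ring"
  proof (rule L.idealI_cring)
    show "K \<subseteq> carrier quintic_ring" by (auto simp: K_def)
    show "\<zero>\<^bsub>quintic_ring\<^esub> \<in> K" unfolding qfrac_zero by (intro K_I mon_ideal_zero) simp
  next
    fix X Y assume "X \<in> K" "Y \<in> K"
    then obtain t s t' s' where *: "X = qfrac t s" "Y = qfrac t' s'" "lookup s 0 \<noteq> 0" "lookup s' 0 \<noteq> 0"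
      "t \<in> mon_ideal P" "t' \<in> mon_ideal P" unfolding K_def by blast
    then have "X \<oplus>\<^bsub>quintic_ring\<^esub> Y = qfrac (s' * t + s * t') (s * s')" "lookup (s * s') 0 \<noteq> 0"
      by (simp_all add: qfrac_add lookup_mult_zero mult.commute)
    moreover have "s' * t + s * t' \<in> mon_ideal P"
      using * P_mono by (intro mon_ideal_add mon_ideal_mult) auto
    ultimately show "X \<oplus>\<^bsub>quintic_ring\<^esub> Y \<in> K" by (simp only: K_I not_False_eq_True)
  next
    fix X Y :: "'k quintic_elem" assume "X \<in> carrier quintic_ring" "Y \<in> K"
    then obtain t s t' s' where *: "X = qfrac t s" "Y = qfrac t' s'" "lookup s 0 \<noteq> 0" "lookup s' 0 \<noteq> 0"
      "t' \<in> mon_ideal P" unfolding K_def carrier_quintic_ring by blast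
    then have "X \<otimes>\<^bsub>quintic_ring\<^esub> Y = qfrac (t * t') (s * s')" "lookup (s * s') 0 \<noteq> 0"
      by (simp_all add: qfrac_mult lookup_mult_zero)
    moreover have "t * t' \<in> mon_ideal P" using * P_mono by (intro mon_ideal_mult) auto
    ultimately show "X \<otimes>\<^bsub>quintic_ring\<^esub> Y \<in> K" by (simp only: K_I not_False_eq_True)
  qed
  moreover have "G \<subseteq> K"
  proof -
    have "poly5_var j ^ 4 \<in> (mon_ideal P :: 'k poly5 set)" if "j \<noteq> i" for j
      unfolding poly5_var_power mon_ideal_mon P_def using that by auto
    then show ?thesis unfolding G_def by (auto intro!: K_I)
  qed
  ultimately have "I \<subseteq> K"
    unfolding I_def by (rule L.genideal_minimal)
  then have "qfrac (a * ?Z) s \<in> K" using aZ by (rule subsetD)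
  then obtain b t where b: "qfrac (a * ?Z) s = qfrac b t" "lookup t 0 \<noteq> 0" "b \<in> mon_ideal P"
    unfolding K_def by blast
  then have "quintic dvd a * ?Z * t - b * s" using s by (simp add: qfrac_eq_iff[OF char2])
  then obtain h where h: "a * ?Z * t - b * s = quintic * h" by (rule dvdE)
  \<comment> \<open>This absorbs the multiple of F left over from passing to polynomials.\<close>
  have "quintic \<in> (mon_ideal P :: 'k poly5 set)"
    unfolding quintic_eq by (intro mon_ideal_sum, unfold mon_ideal_mon P_def) auto
  then have "s * b + h * quintic \<in> mon_ideal P"
    using b(3) P_mono by (intro mon_ideal_add mon_ideal_mult) auto
  also have "s * b + h * quintic = (t * a) * ?Z" using h by (simp add: algebra_simps)
  finally have "t * a \<in> mon_ideal (\<lambda>g. P (\<lambda>k. g k + (if k = i then \<alpha> else \<beta>)))"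
    by (rule mon_ideal_colon)
  moreover have "(\<lambda>g. P (\<lambda>k. g k + (if k = i then \<alpha> else \<beta>))) =
    (\<lambda>g. g i + \<alpha> \<ge> 5 \<or> (\<exists>j. j \<noteq> i \<and> g j + \<beta> \<ge> 4))"
    unfolding P_def by (intro ext) auto
  ultimately show ?thesis using b(2) by auto
qed

lemma cubic_monomials_in_ideal:
  assumes J: "quintic_ideal_char2 J"
    and gens: "\<And>i j. num_in J (poly5_var i ^ 2 * poly5_var j :: 'k::field poly5)"
    and p: "p \<in> mon_ideal (\<lambda>g. \<exists>i j. \<forall>k. (if k = i then 2 else 0) + (if k = j then 1 else 0) \<le> g k)"
  shows "num_in J p"
proof -
  interpret quintic_ideal_char2 J by fact
  show ?thesis
  proof (rule additive_induct[where P = "num_in J" and p = p])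
    fix v and c :: 'k
    assume "v \<in> keys p"
    with p obtain i j where ij: "\<And>k. (if k = i then 2 else 0) + (if k = j then 1 else 0) \<le> lookup v k"
      unfolding mon_ideal_def by blast
    define w where "w = expo (\<lambda>k. lookup v k - ((if k = i then 2 else 0) + (if k = j then 1 else 0)))"
    have "w + expo (\<lambda>k. (if k = i then 2 else 0) + (if k = j then 1 else 0)) = v"
      using ij by (intro poly_mapping_eqI) (simp add: w_def lookup_add)
    then have "single v c = single w c * (poly5_var i ^ 2 * poly5_var j)"
      by (simp only: poly5_var_power poly5_var_eq[of j] mon_mult mult_single mult_1_right expo_add)
    then show "num_in J (single v c)" using num_in_mult[OF gens] by simp
  qed (auto intro: num_in_dvd num_in_add)
qed

theorem mainTheorem1:
  assumes "CHAR('k::field) = 2"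
  shows "test_ideal 2 (quintic_ring :: 'k quintic_elem ring) =
    Idl\<^bsub>quintic_ring\<^esub>
      {quintic_var i [^]\<^bsub>quintic_ring\<^esub> (2::nat) \<otimes>\<^bsub>quintic_ring\<^esub> quintic_var j | i j. True}"
proof -
  interpret L: cring "quintic_ring :: 'k quintic_elem ring" by (rule cring_quintic_ring)
  let ?G = "{quintic_var i [^]\<^bsub>quintic_ring\<^esub> (2::nat) \<otimes>\<^bsub>quintic_ring\<^esub> quintic_var j | i j. True} :: 'k quintic_elem set"
  define J where "J = Idl\<^bsub>quintic_ring\<^esub> ?G"
  have var: "quintic_var i [^]\<^bsub>quintic_ring\<^esub> (2::nat) \<otimes>\<^bsub>quintic_ring\<^esub> quintic_var j =
    qfrac (poly5_var i ^ 2 * poly5_var j :: 'k poly5) 1" for i j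
    by (simp add: quintic_var_eq qfrac_power qfrac_mult)
  have G: "?G \<subseteq> carrier quintic_ring" by (auto simp: var)
  interpret J: quintic_ideal_char2 J
    using L.genideal_ideal[OF G] assms
    by (auto simp: J_def quintic_ideal_char2_def quintic_ideal_char2_axioms_def)
  have gens: "num_in J (poly5_var i ^ 2 * poly5_var j)" for i j
    unfolding J_def using L.genideal_self[OF G] var[of i j] by blast
  have "J \<subseteq> test_ideal 2 quintic_ring"
    unfolding J_def
    by (rule L.genideal_minimal[OF L.test_ideal_is_ideal])
      (auto simp: var intro: cubic_in_test_ideal[OF assms])
  moreover have "test_ideal 2 quintic_ring \<subseteq> J"
  proof
    fix X :: "'k quintic_elem" assume X: "X \<in> test_ideal 2 quintic_ring"
    then have "X \<in> carrier quintic_ring" by (simp add: test_ideal_def)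
    then obtain a s where as: "X = qfrac a s" "lookup s 0 \<noteq> 0"
      unfolding carrier_quintic_ring by blast
    note bound = test_ideal_monomial_bound[OF assms _ _ as(2) X[unfolded as(1)]]
    \<comment> \<open>The monomial x_0^3 with squares of the others, at q = 2 (6 \<ge> 5 and 9 \<ge>
      8): some exponent is at least 2.\<close>
    obtain t0 where t0: "lookup t0 0 \<noteq> 0"
      "t0 * a \<in> mon_ideal (\<lambda>g. g 0 + 3 \<ge> 5 \<or> (\<exists>j. j \<noteq> 0 \<and> g j + 2 \<ge> 4))"
      using bound[of 1 3 2 0] by auto
    \<comment> \<open>The monomial x_i^2 with cubes of the others, at q = 4 (8 \<ge> 5 and 17 \<ge>
      16): the exponent of x_i is at least 3, or another variable occurs. With the first bound this
      forces a divisor x_i^2 x_j.\<close>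
    have "\<forall>i. \<exists>t. lookup t 0 \<noteq> 0 \<and> t * a \<in> mon_ideal (\<lambda>g. g i + 2 \<ge> 5 \<or> (\<exists>j. j \<noteq> i \<and> g j + 3 \<ge> 4))"
      by (intro allI bound[of 2]) simp_all
    from choice[OF this] obtain t where t: "\<And>i. lookup (t i) 0 \<noteq> 0"
      "\<And>i. t i * a \<in> mon_ideal (\<lambda>g. g i + 2 \<ge> 5 \<or> (\<exists>j. j \<noteq> i \<and> g j + 3 \<ge> 4))"
      by auto
    \<comment> \<open>One common unit factor makes all six bounds hold for the same polynomial d
      a.\<close>
    define d where "d = t0 * (\<Prod>i\<in>UNIV. t i)"
    have "lookup (\<Prod>i\<in>A. t i) 0 \<noteq> 0" if "finite A" for A
      using that by (induction A rule: finite_induct) (auto simp: lookup_mult_zero t(1))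
    then have d0: "lookup d 0 \<noteq> 0" by (simp add: d_def lookup_mult_zero t0(1))
    have "d * a = (\<Prod>i\<in>UNIV. t i) * (t0 * a)" by (simp add: d_def mult_ac)
    then have d1: "d * a \<in> mon_ideal (\<lambda>g. g 0 + 3 \<ge> 5 \<or> (\<exists>j. j \<noteq> 0 \<and> g j + 2 \<ge> 4))"
      by (simp only: mon_ideal_mult_bound[OF t0(2)])
    have d2: "d * a \<in> mon_ideal (\<lambda>g. g i + 2 \<ge> 5 \<or> (\<exists>j. j \<noteq> i \<and> g j + 3 \<ge> 4))" for i
    proof -
      have "d * a = (t0 * (\<Prod>j\<in>UNIV - {i}. t j)) * (t i * a)"
        unfolding d_def by (subst prod.remove[of _ i]) (auto simp: mult_ac)
      then show ?thesis
        by (simp only: mon_ideal_mult_bound[OF t(2)[of i]])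
    qed
    have "num_in J (d * a)"
    proof (rule cubic_monomials_in_ideal[OF J.quintic_ideal_char2_axioms gens])
      have "\<exists>i j. \<forall>k. (if k = i then 2 else 0) + (if k = j then 1 else 0) \<le> lookup v k"
        if v: "v \<in> keys (d * a)" for v
      proof -
        have "\<exists>i. lookup v i \<ge> 2"
          using d1 v by (fastforce simp: mon_ideal_def)
        then obtain i where i: "lookup v i \<ge> 2" by blast
        have "lookup v i \<ge> 3 \<or> (\<exists>j. j \<noteq> i \<and> lookup v j \<ge> 1)"
          using d2[of i] v by (fastforce simp: mon_ideal_def)
        then show ?thesis
        proof
          assume "lookup v i \<ge> 3"
          then show ?thesis by (intro exI[of _ i]) auto
        next
          assume "\<exists>j. j \<noteq> i \<and> lookup v j \<ge> 1"
          then obtain j where "j \<noteq> i" "lookup v j \<ge> 1" by blast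
          then show ?thesis using i by (intro exI[of _ i] exI[of _ j]) auto
        qed
      qed
      then show "d * a \<in> mon_ideal (\<lambda>g. \<exists>i j. \<forall>k. (if k = i then 2 else 0) + (if k = j then 1 else 0) \<le> g k)"
        by (simp add: mon_ideal_def)
    qed
    then have "num_in J a" by (rule J.num_in_unit_mult[OF d0])
    then show "X \<in> J" unfolding as(1) by (rule J.qfrac_in_iff[OF as(2), THEN iffD2])
  qed
  ultimately show ?thesis by (simp add: J_def)
qed

end
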